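(* Let $A=(a_{ij})$ be a real $m\times n$ matrix and $S=(s_{kj})$ an $n\times n$ switching-cost matrix. For every $c\ge 0$, the zero-sum game with switching costs $(A,S,c)$ has a value in stationary strategies, denoted $v(c)$; that is, there exist a real number $v(c)$ and stationary strategies $\sigma_c$ of Player 1 and $\tau_c$ of Player 2 such that $\gamma(\sigma_c,\tau)\ge v(c)\ge\gamma(\sigma,\tau_c)$ for all strategies $\sigma$ of Player 1 and $\tau$ of Player 2. The function $c\mapsto v(c)$ on $[0,\infty)$ is continuous, increasing (in the weak sense, i.e. non-decreasing), concave, and piecewise linear with finitely many pieces.
   Context: A zero-sum game with switching costs is a tuple $(A,S,c)$ where $A=(a_{ij})$ is a real $m\times n$ matrix, $c\ge 0$, and $S=(s_{kj})$ is an $n\times n$ matrix (a switching-cost matrix) with $s_{kj}\ge 0$, $s_{jj}=0$ for all $k,j$, normalized so that its smallest nonzero entry is $1$. At each stage $t=1,2,\dots$, Player 1 (the maximizer) chooses a row $i(t)\in\{1,\dots,m\}$ and Player 2 (the minimizer) simultaneously chooses a column $j(t)\in\{1,\dots,n\}$, possibly at random, knowing the history of realized actions. The stage payoff, paid by Player 2 to Player 1, is $u_t=a_{i(t)j(t)}+c\,s_{j(t-1)j(t)}$, with no switching cost paid at $t=1$. For a strategy pair $(\sigma,\tau)$ the payoff is $\gamma(\sigma,\tau)=\mathbb{E}_{\sigma,\tau}\big(\liminf_{T\to\infty}\frac1T\sum_{t=1}^T u_t\big)$. A stationary strategy (of either player) is a strategy in which the mixed action at stage $t$ depends only on the previous action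 $j(t-1)$ of Player 2, i.e. it is a vector of $n$ mixed actions, one for each $j(t-1)\in\{1,\dots,n\}$ (at stage 1 a fixed arbitrary initial state $j(0)$ plays the role of the previous action). *)

theory Defs
  imports "HOL-Probability.Probability"
begin

text \<open>
  Rows of \<open>A\<close> are indexed by \<open>'m\<close> and columns by \<open>'n\<close>, so \<open>A :: real ^ 'n ^ 'm\<close>.
  Stages are numbered from \<open>0\<close>: \<open>\<omega> t\<close> is the action pair of stage \<open>t + 1\<close>.
\<close>

text \<open>
  If \<open>S\<close> is the zero matrix (as is forced when there is a single column), there is no
  smallest nonzero entry and the normalization is void.
\<close>

definition nonzero_entries :: "real ^ 'n ^ 'n \<Rightarrow> real set" where
  "nonzero_entries S = {s. s \<noteq> 0 \<and> (\<exists>k j. s = S $ k $ j)}"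

definition switching_cost_matrix :: "real ^ 'n::finite ^ 'n \<Rightarrow> bool" where
  "switching_cost_matrix S \<longleftrightarrow>
     (\<forall>k j. 0 \<le> S $ k $ j) \<and> (\<forall>j. S $ j $ j = 0) \<and>
     (nonzero_entries S \<noteq> {} \<longrightarrow> Min (nonzero_entries S) = 1)"

text \<open>
  A history is the list of past action pairs in chronological order. The actions of the two
  players at a stage are drawn independently, given the history.
\<close>

type_synonym ('m, 'n, 'a) strategy = "('m \<times> 'n) list \<Rightarrow> 'a pmf"

definition stage_kernel ::
  "('m, 'n, 'm) strategy \<Rightarrow> ('m, 'n, 'n) strategy \<Rightarrow> nat \<Rightarrow> (nat \<Rightarrow> 'm \<times> 'n) \<Rightarrow> ('m \<times> 'n) measure"
  where
  "stage_kernel \<sigma> \<tau> t \<omega> =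
     measure_pmf (pair_pmf (\<sigma> (map \<omega> [0..<t])) (\<tau> (map \<omega> [0..<t])))"

lemma Ionescu_Tulcea_stage_kernel:
  fixes \<sigma> :: "('m::finite, 'n::finite, 'm) strategy"
  shows "Ionescu_Tulcea (stage_kernel \<sigma> \<tau>) (\<lambda>_. count_space UNIV)"
proof (rule Ionescu_Tulcea.intro)
  fix t :: nat
  have "PiM {0..<t} (\<lambda>_. count_space (UNIV :: ('m \<times> 'n) set)) =
      count_space (PiE {0..<t} (\<lambda>_. UNIV))"
    by (intro count_space_PiM_finite) auto
  then show "stage_kernel \<sigma> \<tau> t \<in> PiM {0..<t} (\<lambda>_. count_space UNIV) \<rightarrow>\<^sub>M
      subprob_algebra (count_space UNIV)"
    by (auto simp: stage_kernel_def measure_pmf_in_subprob_algebra)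
qed (simp add: stage_kernel_def measure_pmf.prob_space_axioms)

text \<open>
  The law of the infinite play: the limit measure that the Ionescu-Tulcea theorem builds from
  the stage kernels. The two lemmas after it show that it is a probability measure and has the
  intended finite-dimensional distributions.
\<close>

definition play_measure ::
  "('m, 'n, 'm) strategy \<Rightarrow> ('m, 'n, 'n) strategy \<Rightarrow> (nat \<Rightarrow> 'm \<times> 'n) measure" where
  "play_measure \<sigma> \<tau> =
     projective_family.lim UNIV
       (Ionescu_Tulcea.CI (stage_kernel \<sigma> \<tau>) (\<lambda>_. count_space UNIV)) (\<lambda>_. count_space UNIV)"

lemma prob_space_play_measure:
  fixes \<sigma> :: "('m::finite, 'n::finite, 'm) strategy"
  shows "prob_space (play_measure \<sigma> \<tau>)"
proof -
  interpret Ionescu_Tulcea "stage_kernel \<sigma> \<tau>" "\<lambda>_. count_space UNIV"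
    by (rule Ionescu_Tulcea_stage_kernel)
  have "emeasure PF.lim (PF.emb UNIV {} {\<lambda>_. undefined}) = emeasure (CI {}) {\<lambda>_. undefined}"
    by (intro lim) (auto simp: PiM_empty)
  moreover have "PF.emb UNIV {} {\<lambda>_. undefined} = space PF.lim"
    by (auto simp: prod_emb_def space_PiM)
  moreover have "emeasure (CI {}) {\<lambda>_. undefined} = 1"
    using prob_space.emeasure_space_1[OF PF.prob_space_P[of "{}"]]
    by (simp add: PF.space_P space_PiM)
  ultimately have "emeasure PF.lim (space PF.lim) = 1"
    by simp
  then show ?thesis
    unfolding play_measure_def by (rule prob_spaceI)
qed

lemma emeasure_play_measure_cylinder:
  fixes \<sigma> :: "('m::finite, 'n::finite, 'm) strategy"
  shows "emeasure (play_measure \<sigma> \<tau>) {\<omega>. map \<omega> [0..<length h] = h} =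
    (\<Prod>t<length h. ennreal (pmf (\<sigma> (take t h)) (fst (h ! t)) * pmf (\<tau> (take t h)) (snd (h ! t))))"
proof -
  let ?M = "\<lambda>_::nat. count_space (UNIV :: ('m \<times> 'n) set)"
  let ?x = "\<lambda>h. \<lambda>i\<in>{0..<length h}. (h :: ('m \<times> 'n) list) ! i"
  interpret Ionescu_Tulcea "stage_kernel \<sigma> \<tau>" ?M
    by (rule Ionescu_Tulcea_stage_kernel)
  have PiM: "PiM {0..<t} ?M = count_space (PiE {0..<t} (\<lambda>_. UNIV))" for t
    by (intro count_space_PiM_finite) auto
  have x: "?x h \<in> PiE {0..<length h} (\<lambda>_. UNIV)" for h
    by auto
  have "emeasure (C 0 (length h) (\<lambda>_. undefined)) {?x h} =
    (\<Prod>t<length h. ennreal (pmf (\<sigma> (take t h)) (fst (h ! t)) * pmf (\<tau> (take t h)) (snd (h ! t))))"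
  proof (induction h rule: rev_induct)
    case Nil
    then show ?case
      by (simp add: PiM_empty restrict_def)
  next
    case (snoc a h)
    let ?n = "length h"
    let ?p = "pmf (\<sigma> h) (fst a) * pmf (\<tau> h) (snd a)"
    have u: "(\<lambda>_. undefined) \<in> space (PiM {0..<0} ?M)"
      by (simp add: PiM)
    have xs: "{?x (h @ [a])} \<in> sets (PiM {0..<Suc ?n} ?M)"
      using x[of "h @ [a]"] by (simp add: PiM)
    have sp: "space (C 0 ?n (\<lambda>_. undefined)) = PiE {0..<?n} (\<lambda>_. UNIV)"
      using space_C[OF u, of ?n] by (simp add: PiM)
    have se: "sets (C 0 ?n (\<lambda>_. undefined)) = Pow (PiE {0..<?n} (\<lambda>_. UNIV))"
      using sets_C[OF u, of ?n] by (simp add: PiM)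
    have step: "emeasure (eP ?n y) {?x (h @ [a])} = ennreal ?p * indicator {?x h} y"
      if y: "y \<in> PiE {0..<?n} (\<lambda>_. UNIV)" for y
    proof -
      have iff: "y(?n := b) = ?x (h @ [a]) \<longleftrightarrow> y = ?x h \<and> b = a" for b
      proof
        assume eq: "y(?n := b) = ?x (h @ [a])"
        have "y i = ?x h i" for i
          using fun_cong[OF eq, of i] y
          by (cases "i < ?n") (auto simp: nth_append PiE_iff extensional_def split: if_splits)
        moreover have "b = a"
          using fun_cong[OF eq, of ?n] by simp
        ultimately show "y = ?x h \<and> b = a" by auto
      next
        assume "y = ?x h \<and> b = a"
        then show "y(?n := b) = ?x (h @ [a])"
          by (auto simp: fun_eq_iff nth_append)
      qed
      have "emeasure (eP ?n y) {?x (h @ [a])} =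
          emeasure (stage_kernel \<sigma> \<tau> ?n y) {b. y(?n := b) = ?x (h @ [a])}"
        using y xs by (subst emeasure_eP) (auto simp: PiM vimage_def)
      also have "{b. y(?n := b) = ?x (h @ [a])} = (if y = ?x h then {a} else {})"
        using iff by auto
      also have "emeasure (stage_kernel \<sigma> \<tau> ?n y) \<dots> = ennreal ?p * indicator {?x h} y"
      proof (cases "y = ?x h")
        case True
        then have "map y [0..<?n] = h"
          by (auto intro!: nth_equalityI)
        with True show ?thesis
          by (cases a) (simp add: stage_kernel_def emeasure_pmf_single pmf_pair)
      qed simp
      finally show ?thesis .
    qed
    have "emeasure (C 0 (length (h @ [a])) (\<lambda>_. undefined)) {?x (h @ [a])} =
        (\<integral>\<^sup>+y. emeasure (eP ?n y) {?x (h @ [a])} \<partial>C 0 ?n (\<lambda>_. undefined))"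
      using measurable_eP[of ?n] xs
      by (simp, subst emeasure_bind)
        (auto simp: sp measurable_cong_sets[OF sets_C[OF u] refl])
    also have "\<dots> = (\<integral>\<^sup>+y. ennreal ?p * indicator {?x h} y \<partial>C 0 ?n (\<lambda>_. undefined))"
      using step by (intro nn_integral_cong) (simp add: sp)
    also have "\<dots> = ennreal ?p * emeasure (C 0 ?n (\<lambda>_. undefined)) {?x h}"
      using x[of h] by (intro nn_integral_cmult_indicator) (simp add: se)
    also have "\<dots> = (\<Prod>t<length (h @ [a]). ennreal (pmf (\<sigma> (take t (h @ [a]))) (fst ((h @ [a]) ! t)) *
        pmf (\<tau> (take t (h @ [a]))) (snd ((h @ [a]) ! t))))"
      unfolding snoc.IH by (simp add: nth_append mult.commute)
    finally show ?case .
  qed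
  also have "emeasure (C 0 (length h) (\<lambda>_. undefined)) {?x h} =
      emeasure (CI {0..<length h}) {?x h}"
    using x[of h] emeasure_CI[of "{0..<length h}" "length h" "{?x h}"]
      prod_emb_id[of "{?x h}" "{0..<length h}" ?M]
    by (simp add: PiM del: restrict_apply)
  also have "\<dots> = emeasure PF.lim (PF.emb UNIV {0..<length h} {?x h})"
    using x[of h] by (intro lim[symmetric]) (simp_all add: PiM del: restrict_apply)
  also have "PF.emb UNIV {0..<length h} {?x h} = {\<omega>. map \<omega> [0..<length h] = h}"
  proof -
    have "restrict \<omega> {0..<length h} = ?x h \<longleftrightarrow> map \<omega> [0..<length h] = h" for \<omega>
    proof
      assume eq: "restrict \<omega> {0..<length h} = ?x h"
      have "\<omega> i = h ! i" if "i < length h" for i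
        using fun_cong[OF eq, of i] that by simp
      then show "map \<omega> [0..<length h] = h"
        by (intro nth_equalityI) auto
    next
      assume eq: "map \<omega> [0..<length h] = h"
      have "\<omega> i = h ! i" if "i < length h" for i
        using arg_cong[OF eq, of "\<lambda>l. l ! i"] that by simp
      then show "restrict \<omega> {0..<length h} = ?x h"
        by (intro restrict_ext) simp
    qed
    then show ?thesis
      by (simp add: prod_emb_def space_PiM PiE_def vimage_def del: restrict_apply)
  qed
  finally show ?thesis
    unfolding play_measure_def .
qed

definition stage_payoff ::
  "real ^ 'n ^ 'm \<Rightarrow> real ^ 'n ^ 'n \<Rightarrow> real \<Rightarrow> (nat \<Rightarrow> 'm \<times> 'n) \<Rightarrow> nat \<Rightarrow> real" where
  "stage_payoff A S c \<omega> t =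
     A $ fst (\<omega> t) $ snd (\<omega> t) +
     (if t = 0 then 0 else c * S $ snd (\<omega> (t - 1)) $ snd (\<omega> t))"

text \<open>
  The limit inferior is taken in \<open>ereal\<close>, since \<open>liminf\<close> needs a complete lattice. The stage
  payoffs are bounded, so the limit inferior is finite and \<open>real_of_ereal\<close> loses nothing.
\<close>

definition liminf_average ::
  "real ^ 'n ^ 'm \<Rightarrow> real ^ 'n ^ 'n \<Rightarrow> real \<Rightarrow> (nat \<Rightarrow> 'm \<times> 'n) \<Rightarrow> real" where
  "liminf_average A S c \<omega> =
     real_of_ereal (liminf (\<lambda>T. ereal ((\<Sum>t<T. stage_payoff A S c \<omega> t) / real T)))"

definition payoff ::
  "real ^ 'n ^ 'm \<Rightarrow> real ^ 'n ^ 'n \<Rightarrow> real \<Rightarrow>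
   ('m, 'n, 'm) strategy \<Rightarrow> ('m, 'n, 'n) strategy \<Rightarrow> real" where
  "payoff A S c \<sigma> \<tau> = (LINT \<omega>|play_measure \<sigma> \<tau>. liminf_average A S c \<omega>)"

definition previous_column :: "'n \<Rightarrow> ('m \<times> 'n) list \<Rightarrow> 'n" where
  "previous_column j0 h = (if h = [] then j0 else snd (last h))"

definition stationary :: "'n \<Rightarrow> ('m, 'n, 'a) strategy \<Rightarrow> bool" where
  "stationary j0 \<sigma> \<longleftrightarrow> (\<exists>x. \<forall>h. \<sigma> h = x (previous_column j0 h))"

definition stationary_value ::
  "real ^ 'n::finite ^ 'm::finite \<Rightarrow> real ^ 'n ^ 'n \<Rightarrow> real \<Rightarrow> 'n \<Rightarrow> real \<Rightarrow> bool" where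
  "stationary_value A S c j0 v \<longleftrightarrow>
     (\<exists>\<sigma>\<^sub>c \<tau>\<^sub>c. stationary j0 \<sigma>\<^sub>c \<and> stationary j0 \<tau>\<^sub>c \<and>
        (\<forall>\<tau>. payoff A S c \<sigma>\<^sub>c \<tau> \<ge> v) \<and> (\<forall>\<sigma>. v \<ge> payoff A S c \<sigma> \<tau>\<^sub>c))"

definition affine_on :: "real set \<Rightarrow> (real \<Rightarrow> real) \<Rightarrow> bool" where
  "affine_on I f \<longleftrightarrow> (\<exists>p q. \<forall>x\<in>I. f x = p * x + q)"

definition finitely_piecewise_linear :: "(real \<Rightarrow> real) \<Rightarrow> bool" where
  "finitely_piecewise_linear f \<longleftrightarrow>
     (\<exists>(r::nat) b. b 0 = 0 \<and> (\<forall>i<r. b i < b (Suc i)) \<and>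
        (\<forall>i<r. affine_on {b i..b (Suc i)} f) \<and> affine_on {b r..} f)"

end

theory Submission
  imports Defs
begin

text \<open>
  The previous column is a state that Player 2 alone controls, so the game is a stochastic game
  with a single controller, and such games are solved by linear programming. For a potential
  \<open>\<phi>\<close> on the columns let \<open>excess A S c \<phi> v k i j = A\<^sub>i\<^sub>j + c S\<^sub>k\<^sub>j + \<phi>\<^sub>j - \<phi>\<^sub>k - v\<close>. Along a play
  the potential terms telescope, so the average of the excess differs from the average payoff
  minus \<open>v\<close> only by \<open>O(1/T)\<close>. A stationary strategy that keeps the conditional mean of the excess
  nonnegative (for Player 1) or nonpositive (for Player 2), whatever the opponent does,
  therefore guarantees \<open>v\<close>. The limit inferior stands inside the expectation, so this is proved
  almost surely, by an exponential moment bound (\<open>AE_eventually_sum_ge\<close>).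

  Candidates for \<open>v\<close> come from flows: the long-run frequencies \<open>z\<^sub>k\<^sub>j\<close> of the transitions from
  column \<open>k\<close> to column \<open>j\<close> form a circulation of total mass \<open>1\<close>. With \<open>w\<^sub>k\<close> an upper bound for
  what Player 1 can earn in state \<open>k\<close> against \<open>z\<close>, Player 2 wants to minimize
  \<open>\<Sum>\<^sub>k w\<^sub>k + c \<Sum>\<^sub>k\<^sub>j S\<^sub>k\<^sub>j z\<^sub>k\<^sub>j\<close>. The pairs \<open>(z, w)\<close> range over a polytope that does not depend on \<open>c\<close>, and
  \<open>v(c)\<close> is the minimum.

  \<^item> Player 1 guarantees the minimum: a separation argument (\<open>potential_or_circulation\<close>) yields
    either mixed actions and a potential with nonnegative mean excess, or a flow of smaller cost
    (\<open>ex_optimal_potential\<close>).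
  \<^item> Player 2 guarantees the minimum by playing, in state \<open>k\<close>, the conditional distribution of an
    optimal flow \<open>z\<close>. Complementary slackness shows that the potential of Player 1 also serves
    Player 2 on the states that \<open>z\<close> visits. From any other state Player 2 moves at once to
    a visited one, and a large potential there pays for the move
    (\<open>stationary_value_of_optimal_flow\<close>).

  A linear cost attains its minimum over a polytope at one of the finitely many points that span
  it. Hence \<open>v\<close> is a minimum of finitely many functions affine in \<open>c\<close>, whose slopes, the switching
  rates, are nonnegative. This makes \<open>v\<close> concave, continuous, nondecreasing and piecewise linear.
\<close>

section \<open>Almost sure lower bounds for sums along a play\<close>

lemma sets_play_measure [measurable_cong]:
  fixes \<sigma> :: "('m::finite, 'n::finite, 'm) strategy"
  shows "sets (play_measure \<sigma> \<tau>) = sets (PiM UNIV (\<lambda>_. count_space UNIV))"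
proof -
  interpret Ionescu_Tulcea "stage_kernel \<sigma> \<tau>" "\<lambda>_. count_space UNIV"
    by (rule Ionescu_Tulcea_stage_kernel)
  show ?thesis
    unfolding play_measure_def by simp
qed

lemma space_play_measure [simp]:
  fixes \<sigma> :: "('m::finite, 'n::finite, 'm) strategy"
  shows "space (play_measure \<sigma> \<tau>) = UNIV"
  using sets_eq_imp_space_eq[OF sets_play_measure] by (simp add: space_PiM)

lemma measurable_action [measurable]:
  fixes \<sigma> :: "('m::finite, 'n::finite, 'm) strategy"
  shows "(\<lambda>\<omega>. \<omega> t) \<in> play_measure \<sigma> \<tau> \<rightarrow>\<^sub>M count_space UNIV"
  by measurable

definition prefix_prob ::
  "('m, 'n, 'm) strategy \<Rightarrow> ('m, 'n, 'n) strategy \<Rightarrow> ('m \<times> 'n) list \<Rightarrow> real" where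
  "prefix_prob \<sigma> \<tau> h =
     (\<Prod>t<length h. pmf (\<sigma> (take t h)) (fst (h ! t)) * pmf (\<tau> (take t h)) (snd (h ! t)))"

lemma prefix_prob_nonneg: "0 \<le> prefix_prob \<sigma> \<tau> h"
  unfolding prefix_prob_def by (intro prod_nonneg) auto

lemma prefix_prob_snoc:
  "prefix_prob \<sigma> \<tau> (h @ [a]) = prefix_prob \<sigma> \<tau> h * (pmf (\<sigma> h) (fst a) * pmf (\<tau> h) (snd a))"
  unfolding prefix_prob_def by (simp add: nth_append)

lemma sets_prefix_cylinder:
  fixes \<sigma> :: "('m::finite, 'n::finite, 'm) strategy"
  shows "{\<omega>. map \<omega> [0..<length h] = h} \<in> sets (play_measure \<sigma> \<tau>)"
proof -
  have "{\<omega>. map \<omega> [0..<length h] = h} =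
      {\<omega> \<in> space (play_measure \<sigma> \<tau>). \<forall>t\<in>{..<length h}. \<omega> t = h ! t}"
    unfolding list_eq_iff_nth_eq by auto
  also have "\<dots> \<in> sets (play_measure \<sigma> \<tau>)"
  proof (rule sets.sets_Collect_finite_All)
    fix t
    show "{\<omega> \<in> space (play_measure \<sigma> \<tau>). \<omega> t = h ! t} \<in> sets (play_measure \<sigma> \<tau>)"
      using measurable_sets[OF measurable_action, of "{h ! t}" t \<sigma> \<tau>] by (simp add: vimage_def)
  qed simp
  finally show ?thesis .
qed

text \<open>
  Only finitely many prefixes of a given length exist, which reduces measurability and integrals
  of functions of a prefix to the probabilities of cylinders.
\<close>

lemma prefix_function_eq_sum:
  fixes g :: "('a::finite) list \<Rightarrow> ennreal"
  shows "(\<lambda>\<omega>. g (map \<omega> [0..<T])) =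
    (\<lambda>\<omega>. \<Sum>h | length h = T. g h * indicator {\<omega>. map \<omega> [0..<length h] = h} \<omega>)"
proof
  fix \<omega> :: "nat \<Rightarrow> 'a"
  have fin: "finite {h :: 'a list. length h = T}"
    using finite_lists_length_eq[of "UNIV :: 'a set" T] by simp
  have "(\<Sum>h | length h = T. g h * indicator {\<omega>. map \<omega> [0..<length h] = h} \<omega>) =
      (\<Sum>h | length h = T. if h = map \<omega> [0..<T] then g h else 0)"
    by (intro sum.cong) (auto simp: indicator_def)
  then show "g (map \<omega> [0..<T]) =
      (\<Sum>h | length h = T. g h * indicator {\<omega>. map \<omega> [0..<length h] = h} \<omega>)"
    using fin by simp
qed

lemma borel_measurable_prefix:
  fixes \<sigma> :: "('m::finite, 'n::finite, 'm) strategy" and g :: "('m \<times> 'n) list \<Rightarrow> ennreal"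
  shows "(\<lambda>\<omega>. g (map \<omega> [0..<T])) \<in> borel_measurable (play_measure \<sigma> \<tau>)"
  by (subst prefix_function_eq_sum[of g T])
    (intro borel_measurable_sum borel_measurable_times_ennreal borel_measurable_const
      borel_measurable_indicator sets_prefix_cylinder)

lemma nn_integral_prefix:
  fixes \<sigma> :: "('m::finite, 'n::finite, 'm) strategy" and g :: "('m \<times> 'n) list \<Rightarrow> ennreal"
  shows "(\<integral>\<^sup>+\<omega>. g (map \<omega> [0..<T]) \<partial>play_measure \<sigma> \<tau>) =
    (\<Sum>h | length h = T. g h * ennreal (prefix_prob \<sigma> \<tau> h))"
proof -
  let ?cyl = "\<lambda>h. {\<omega> :: nat \<Rightarrow> 'm \<times> 'n. map \<omega> [0..<length h] = h}"
  have cyl: "emeasure (play_measure \<sigma> \<tau>) (?cyl h) = ennreal (prefix_prob \<sigma> \<tau> h)" for h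
    by (simp add: emeasure_play_measure_cylinder prefix_prob_def prod_ennreal)
  have "(\<integral>\<^sup>+\<omega>. g (map \<omega> [0..<T]) \<partial>play_measure \<sigma> \<tau>) =
      (\<Sum>h | length h = T. \<integral>\<^sup>+\<omega>. g h * indicator (?cyl h) \<omega> \<partial>play_measure \<sigma> \<tau>)"
    by (subst prefix_function_eq_sum[of g T])
      (intro nn_integral_sum borel_measurable_times_ennreal borel_measurable_const
        borel_measurable_indicator sets_prefix_cylinder)
  also have "\<dots> = (\<Sum>h | length h = T. g h * emeasure (play_measure \<sigma> \<tau>) (?cyl h))"
    by (intro sum.cong nn_integral_cmult_indicator sets_prefix_cylinder refl)
  also have "\<dots> = (\<Sum>h | length h = T. g h * ennreal (prefix_prob \<sigma> \<tau> h))"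
    by (simp only: cyl)
  finally show ?thesis .
qed

lemma sum_lists_length_Suc:
  fixes G :: "('a::finite) list \<Rightarrow> 'b::comm_monoid_add"
  shows "(\<Sum>h | length h = Suc T. G h) = (\<Sum>h | length h = T. \<Sum>a\<in>UNIV. G (h @ [a]))"
proof -
  have "bij_betw (\<lambda>(h, a). h @ [a]) ({h :: 'a list. length h = T} \<times> UNIV) {h. length h = Suc T}"
    by (rule bij_betw_byWitness[where f' = "\<lambda>h. (butlast h, last h)"])
      (auto, metis append_butlast_last_id length_0_conv nat.simps(3))
  from sum.reindex_bij_betw[OF this, of G] show ?thesis
    by (simp add: sum.cartesian_product case_prod_beta)
qed

text \<open>
  For negative \<open>y = - u\<close> the bound follows from \<open>(1 - u + u\<^sup>2) (1 + u + u\<^sup>2 / 2) \<ge> 1\<close>.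
\<close>

lemma exp_le_quadratic:
  fixes y :: real
  assumes "\<bar>y\<bar> \<le> 1"
  shows "exp y \<le> 1 + y + y\<^sup>2"
proof (cases "0 \<le> y")
  case True
  then show ?thesis using assms exp_bound[of y] by simp
next
  case False
  define u where "u = - y"
  have u: "0 \<le> u" using False by (simp add: u_def)
  have ge: "1 + u + u\<^sup>2 / 2 \<le> exp u"
    using exp_lower_Taylor_quadratic[OF u] .
  have "(1 - u + u\<^sup>2) * (1 + u + u\<^sup>2 / 2) = 1 + u\<^sup>2 / 2 + u ^ 3 / 2 + u ^ 4 / 2"
    by (simp add: field_simps power2_eq_square power3_eq_cube power4_eq_xxxx)
  then have "1 \<le> (1 - u + u\<^sup>2) * (1 + u + u\<^sup>2 / 2)"
    using u by simp
  also have "\<dots> \<le> (1 - u + u\<^sup>2) * exp u"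
  proof (intro mult_left_mono ge)
    show "0 \<le> 1 - u + u\<^sup>2"
      using zero_le_power2[of "u - 1/2"] by (simp add: power2_eq_square algebra_simps)
  qed
  finally have "exp (- u) \<le> 1 - u + u\<^sup>2"
    by (simp add: exp_minus field_simps)
  then show ?thesis by (simp add: u_def)
qed

lemma sum_joint_pmf:
  fixes p :: "'m::finite pmf" and q :: "'n::finite pmf"
  shows "(\<Sum>a\<in>UNIV. pmf p (fst a) * pmf q (snd a)) = 1"
proof -
  have "(\<Sum>a\<in>UNIV. pmf p (fst a) * pmf q (snd a)) = (\<Sum>a\<in>UNIV. pmf (pair_pmf p q) a)"
    by (intro sum.cong) (auto simp: pmf_pair)
  also have "\<dots> = 1"
    by (rule sum_pmf_eq_1) auto
  finally show ?thesis .
qed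

text \<open>
  Let \<open>D T\<close> be the partial sum shifted by \<open>\<epsilon> T\<close>. Its increments are bounded and have conditional
  mean at least \<open>\<epsilon>\<close>, so for a small \<open>l > 0\<close> each step multiplies the mean of \<open>exp (- l D)\<close> by at
  most some \<open>q < 1\<close>. The means are then summable, almost surely \<open>exp (- l D T)\<close> is summable over
  \<open>T\<close>, and \<open>D T\<close> is eventually positive. This takes the place of a strong law for martingale
  differences.
\<close>

lemma AE_eventually_sum_ge:
  fixes \<sigma> :: "('m::finite, 'n::finite, 'm) strategy"
    and f :: "('m \<times> 'n) list \<Rightarrow> 'm \<times> 'n \<Rightarrow> real"
  assumes bound: "\<And>h a. \<bar>f h a\<bar> \<le> B"
    and drift: "\<And>h. 0 \<le> (\<Sum>a\<in>UNIV. pmf (\<sigma> h) (fst a) * pmf (\<tau> h) (snd a) * f h a)"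
    and "\<epsilon> > 0"
  shows "AE \<omega> in play_measure \<sigma> \<tau>. \<forall>\<^sub>F T in sequentially.
    - \<epsilon> * real T \<le> (\<Sum>t<T. f (map \<omega> [0..<t]) (\<omega> t))"
proof -
  define C where "C = B + \<epsilon>"
  have "0 \<le> B" using bound[of undefined undefined] by linarith
  then have C: "0 < C" "\<epsilon> \<le> C" using \<open>\<epsilon> > 0\<close> by (auto simp: C_def)
  \<comment> \<open>the minimizer of the bound \<open>1 - l \<epsilon> + (l C)\<^sup>2\<close> on the growth factor per step\<close>
  define l where "l = \<epsilon> / (2 * C\<^sup>2)"
  have l: "0 < l" using \<open>\<epsilon> > 0\<close> C by (simp add: l_def)
  have lC: "l * C \<le> 1"
    using C \<open>\<epsilon> > 0\<close> by (simp add: l_def power2_eq_square field_simps)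
  define q where "q = 1 - \<epsilon>\<^sup>2 / (4 * C\<^sup>2)"
  have q_eq: "q = 1 - l * \<epsilon> + (l * C)\<^sup>2"
    using C by (simp add: q_def l_def power2_eq_square field_simps)
  have "\<epsilon>\<^sup>2 \<le> (2 * C)\<^sup>2" using C \<open>\<epsilon> > 0\<close> by (intro power_mono) auto
  then have "\<epsilon>\<^sup>2 / (4 * C\<^sup>2) \<le> 1" using C by (simp add: power_mult_distrib)
  moreover have "0 < \<epsilon>\<^sup>2 / (4 * C\<^sup>2)" using C \<open>\<epsilon> > 0\<close> by simp
  ultimately have q: "0 \<le> q" "q < 1"
    by (auto simp: q_def)
  define D where "D h = (\<Sum>t<length h. f (take t h) (h ! t) + \<epsilon>)" for h
  have D_snoc: "D (h @ [a]) = D h + (f h a + \<epsilon>)" for h a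
    by (simp add: D_def nth_append)
  have D_map: "D (map \<omega> [0..<T]) = (\<Sum>t<T. f (map \<omega> [0..<t]) (\<omega> t)) + \<epsilon> * real T" for \<omega> T
    by (simp add: D_def take_map sum.distrib mult.commute)
  have step: "(\<Sum>a\<in>UNIV. pmf (\<sigma> h) (fst a) * pmf (\<tau> h) (snd a) * exp (- l * (f h a + \<epsilon>))) \<le> q" for h
  proof -
    let ?p = "\<lambda>a. pmf (\<sigma> h) (fst a) * pmf (\<tau> h) (snd a)"
    have "exp (- l * (f h a + \<epsilon>)) \<le> q - l * f h a" for a
    proof -
      have b: "\<bar>f h a + \<epsilon>\<bar> \<le> C"
        using bound[of h a] \<open>\<epsilon> > 0\<close> by (auto simp: C_def)
      then have lb: "\<bar>- l * (f h a + \<epsilon>)\<bar> \<le> l * C"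
        using l by (simp add: abs_mult)
      then have "exp (- l * (f h a + \<epsilon>)) \<le> 1 + - l * (f h a + \<epsilon>) + (- l * (f h a + \<epsilon>))\<^sup>2"
        using lC by (intro exp_le_quadratic) linarith
      moreover have "(- l * (f h a + \<epsilon>))\<^sup>2 \<le> (l * C)\<^sup>2"
        using lb by (rule power2_le_iff_abs_le[THEN iffD2, rotated]) (use l C in auto)
      ultimately show ?thesis
        unfolding q_eq by (simp add: algebra_simps)
    qed
    then have "(\<Sum>a\<in>UNIV. ?p a * exp (- l * (f h a + \<epsilon>))) \<le> (\<Sum>a\<in>UNIV. ?p a * (q - l * f h a))"
      by (intro sum_mono mult_left_mono) auto
    also have "\<dots> = q * (\<Sum>a\<in>UNIV. ?p a) - l * (\<Sum>a\<in>UNIV. ?p a * f h a)"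
      by (simp add: sum_distrib_left algebra_simps sum_subtractf)
    also have "\<dots> \<le> q"
      using drift[of h] l by (simp add: sum_joint_pmf)
    finally show ?thesis .
  qed
  have decay: "(\<Sum>h | length h = T. exp (- l * D h) * prefix_prob \<sigma> \<tau> h) \<le> q ^ T" for T
  proof (induction T)
    case 0
    then show ?case by (simp add: D_def prefix_prob_def)
  next
    case (Suc T)
    have "(\<Sum>h | length h = Suc T. exp (- l * D h) * prefix_prob \<sigma> \<tau> h) =
        (\<Sum>h | length h = T. exp (- l * D h) * prefix_prob \<sigma> \<tau> h *
          (\<Sum>a\<in>UNIV. pmf (\<sigma> h) (fst a) * pmf (\<tau> h) (snd a) * exp (- l * (f h a + \<epsilon>))))"
    proof (subst sum_lists_length_Suc, intro sum.cong refl)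
      fix h
      have "exp (- l * D (h @ [a])) = exp (- l * D h) * exp (- l * (f h a + \<epsilon>))" for a
        unfolding D_snoc by (simp add: exp_add[symmetric] algebra_simps)
      then show "(\<Sum>a\<in>UNIV. exp (- l * D (h @ [a])) * prefix_prob \<sigma> \<tau> (h @ [a])) =
          exp (- l * D h) * prefix_prob \<sigma> \<tau> h *
          (\<Sum>a\<in>UNIV. pmf (\<sigma> h) (fst a) * pmf (\<tau> h) (snd a) * exp (- l * (f h a + \<epsilon>)))"
        unfolding prefix_prob_snoc sum_distrib_left by (intro sum.cong) simp_all
    qed
    also have "\<dots> \<le> (\<Sum>h | length h = T. exp (- l * D h) * prefix_prob \<sigma> \<tau> h * q)"
      by (intro sum_mono mult_left_mono step mult_nonneg_nonneg prefix_prob_nonneg) simp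
    also have "\<dots> = (\<Sum>h | length h = T. exp (- l * D h) * prefix_prob \<sigma> \<tau> h) * q"
      by (rule sum_distrib_right[symmetric])
    also have "\<dots> \<le> q ^ T * q"
      by (intro mult_right_mono Suc.IH q)
    finally show ?case by (simp add: mult.commute)
  qed
  let ?X = "\<lambda>T \<omega>. ennreal (exp (- l * D (map \<omega> [0..<T])))"
  have mean: "(\<integral>\<^sup>+\<omega>. ?X T \<omega> \<partial>play_measure \<sigma> \<tau>) \<le> ennreal (q ^ T)" for T
  proof -
    have "(\<integral>\<^sup>+\<omega>. ?X T \<omega> \<partial>play_measure \<sigma> \<tau>) =
        (\<Sum>h | length h = T. ennreal (exp (- l * D h)) * ennreal (prefix_prob \<sigma> \<tau> h))"
      by (rule nn_integral_prefix)
    also have "\<dots> = ennreal (\<Sum>h | length h = T. exp (- l * D h) * prefix_prob \<sigma> \<tau> h)"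
      by (simp add: ennreal_mult[symmetric] prefix_prob_nonneg)
    also have "\<dots> \<le> ennreal (q ^ T)"
      by (intro ennreal_leI decay)
    finally show ?thesis .
  qed
  have measX [measurable]: "?X T \<in> borel_measurable (play_measure \<sigma> \<tau>)" for T
    by (rule borel_measurable_prefix)
  have "(\<integral>\<^sup>+\<omega>. (\<Sum>T. ?X T \<omega>) \<partial>play_measure \<sigma> \<tau>) = (\<Sum>T. \<integral>\<^sup>+\<omega>. ?X T \<omega> \<partial>play_measure \<sigma> \<tau>)"
    by (intro nn_integral_suminf) measurable
  also have "\<dots> \<le> (\<Sum>T. ennreal (q ^ T))"
    by (intro suminf_le mean) auto
  also have "\<dots> = ennreal (\<Sum>T. q ^ T)"
    using q by (intro suminf_ennreal_eq summable_sums summable_geometric) auto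
  also have "\<dots> < \<infinity>" by simp
  finally have finite_mean: "(\<integral>\<^sup>+\<omega>. (\<Sum>T. ?X T \<omega>) \<partial>play_measure \<sigma> \<tau>) \<noteq> \<infinity>"
    by simp
  have "AE \<omega> in play_measure \<sigma> \<tau>. (\<Sum>T. ?X T \<omega>) \<noteq> \<infinity>"
    by (intro nn_integral_noteq_infinite[OF _ finite_mean] borel_measurable_suminf_order measX)
  then show ?thesis
  proof eventually_elim
    case (elim \<omega>)
    then have "summable (\<lambda>T. exp (- l * D (map \<omega> [0..<T])))"
      by (intro summable_suminf_not_top) auto
    then have "(\<lambda>T. exp (- l * D (map \<omega> [0..<T]))) \<longlonglongrightarrow> 0"
      by (rule summable_LIMSEQ_zero)
    then have "\<forall>\<^sub>F T in sequentially. exp (- l * D (map \<omega> [0..<T])) < 1"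
      by (rule order_tendstoD) simp
    then show ?case
    proof eventually_elim
      case (elim T)
      then have "0 < D (map \<omega> [0..<T])"
        using l by (simp add: zero_less_mult_iff)
      then show ?case by (simp add: D_map)
    qed
  qed
qed

section \<open>Verification of stationary strategies by potentials\<close>

lemma abs_entry_le_norm:
  fixes A :: "real ^ 'n::finite ^ 'm::finite"
  shows "\<bar>A $ i $ j\<bar> \<le> norm A"
  by (rule order.trans[OF component_le_norm_cart Finite_Cartesian_Product.norm_nth_le])

lemma abs_cost_le:
  fixes S :: "real ^ 'n::finite ^ 'n"
  shows "\<bar>c * S $ k $ j\<bar> \<le> \<bar>c\<bar> * norm S"
  by (simp add: abs_mult mult_left_mono abs_entry_le_norm)

lemma abs_stage_payoff_le:
  fixes A :: "real ^ 'n::finite ^ 'm::finite"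
  shows "\<bar>stage_payoff A S c \<omega> t\<bar> \<le> norm A + \<bar>c\<bar> * norm S"
  using abs_entry_le_norm[of A "fst (\<omega> t)" "snd (\<omega> t)"]
    abs_cost_le[of c S "snd (\<omega> (t - 1))" "snd (\<omega> t)"]
  by (auto simp: stage_payoff_def)

lemma abs_average_le:
  fixes A :: "real ^ 'n::finite ^ 'm::finite"
  shows "\<bar>(\<Sum>t<T. stage_payoff A S c \<omega> t) / real T\<bar> \<le> norm A + \<bar>c\<bar> * norm S"
proof (cases "T = 0")
  case False
  have "\<bar>\<Sum>t<T. stage_payoff A S c \<omega> t\<bar> \<le> (\<Sum>t<T. \<bar>stage_payoff A S c \<omega> t\<bar>)"
    by (rule sum_abs)
  also have "\<dots> \<le> (\<Sum>t<T. norm A + \<bar>c\<bar> * norm S)"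
    by (intro sum_mono abs_stage_payoff_le)
  finally show ?thesis
    using False by (simp add: field_simps)
qed simp

lemma average_bounds:
  fixes A :: "real ^ 'n::finite ^ 'm::finite"
  shows "- (norm A + \<bar>c\<bar> * norm S) \<le> (\<Sum>t<T. stage_payoff A S c \<omega> t) / real T"
    and "(\<Sum>t<T. stage_payoff A S c \<omega> t) / real T \<le> norm A + \<bar>c\<bar> * norm S"
  using abs_average_le[where A = A and S = S and c = c and \<omega> = \<omega> and T = T] by linarith+

text \<open>
  The averages are bounded, so the conversion to a real number is faithful for every play.
\<close>

lemma ereal_liminf_average:
  fixes A :: "real ^ 'n::finite ^ 'm::finite"
  shows "ereal (liminf_average A S c \<omega>) =
    liminf (\<lambda>T. ereal ((\<Sum>t<T. stage_payoff A S c \<omega> t) / real T))" (is "_ = liminf ?a")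
proof -
  let ?M = "norm A + \<bar>c\<bar> * norm S"
  have "ereal (- ?M) \<le> ?a T" "?a T \<le> ereal ?M" for T
    using average_bounds[where A = A and S = S and c = c and \<omega> = \<omega> and T = T] by simp_all
  then have "ereal (- ?M) \<le> liminf ?a" "liminf ?a \<le> ereal ?M"
    by (auto intro!: Liminf_bounded Liminf_le always_eventually)
  then have "\<bar>liminf ?a\<bar> \<noteq> \<infinity>"
    by auto
  then show ?thesis
    unfolding liminf_average_def by (rule ereal_real')
qed

lemma liminf_average_ge:
  fixes A :: "real ^ 'n::finite ^ 'm::finite"
  assumes "\<forall>\<^sub>F T in sequentially. w \<le> (\<Sum>t<T. stage_payoff A S c \<omega> t) / real T"
  shows "w \<le> liminf_average A S c \<omega>"
proof -
  have "ereal w \<le> ereal (liminf_average A S c \<omega>)"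
    unfolding ereal_liminf_average using assms by (intro Liminf_bounded) simp
  then show ?thesis by simp
qed

lemma liminf_average_le:
  fixes A :: "real ^ 'n::finite ^ 'm::finite"
  assumes "\<forall>\<^sub>F T in sequentially. (\<Sum>t<T. stage_payoff A S c \<omega> t) / real T \<le> w"
  shows "liminf_average A S c \<omega> \<le> w"
proof -
  have "ereal (liminf_average A S c \<omega>) \<le> ereal w"
    unfolding ereal_liminf_average using assms by (intro Liminf_le) simp_all
  then show ?thesis by simp
qed

lemma integrable_liminf_average:
  fixes A :: "real ^ 'n::finite ^ 'm::finite"
  shows "integrable (play_measure \<sigma> \<tau>) (liminf_average A S c)"
proof -
  interpret prob_space "play_measure \<sigma> \<tau>"
    by (rule prob_space_play_measure)
  have "(\<lambda>\<omega>. stage_payoff A S c \<omega> t) \<in> borel_measurable (play_measure \<sigma> \<tau>)" for t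
  proof -
    have "(\<lambda>\<omega>. A $ fst (\<omega> t) $ snd (\<omega> t)) \<in> borel_measurable (play_measure \<sigma> \<tau>)"
      by (rule measurable_compose[OF measurable_action, of "\<lambda>a. A $ fst a $ snd a"]) simp
    moreover have "(\<lambda>\<omega>. S $ snd (\<omega> (t - 1)) $ snd (\<omega> t)) \<in> borel_measurable (play_measure \<sigma> \<tau>)"
    proof (rule measurable_compose_countable'[where I = UNIV and g = "\<lambda>\<omega>. snd (\<omega> t)"])
      fix j
      show "(\<lambda>\<omega>. S $ snd (\<omega> (t - 1)) $ j) \<in> borel_measurable (play_measure \<sigma> \<tau>)"
        by (rule measurable_compose[OF measurable_action, of "\<lambda>a. S $ snd a $ j"]) simp
      show "(\<lambda>\<omega>. snd (\<omega> t)) \<in> play_measure \<sigma> \<tau> \<rightarrow>\<^sub>M count_space UNIV"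
        by (rule measurable_compose[OF measurable_action]) simp
    qed (auto intro: countable_finite)
    ultimately show ?thesis
      unfolding stage_payoff_def by simp
  qed
  then have "liminf_average A S c \<in> borel_measurable (play_measure \<sigma> \<tau>)"
    unfolding liminf_average_def[abs_def] by measurable
  moreover have "\<bar>liminf_average A S c \<omega>\<bar> \<le> norm A + \<bar>c\<bar> * norm S" for \<omega>
  proof -
    have "- (norm A + \<bar>c\<bar> * norm S) \<le> liminf_average A S c \<omega>"
      "liminf_average A S c \<omega> \<le> norm A + \<bar>c\<bar> * norm S"
      by (intro liminf_average_ge liminf_average_le always_eventually allI average_bounds)+
    then show ?thesis by linarith
  qed
  ultimately show ?thesis
    by (intro integrable_const_bound) auto
qed

text \<open>
  The one-stage defect in the average-payoff optimality equation with value \<open>v\<close> and relative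
  values \<open>\<phi>\<close>, in state \<open>k\<close>.
\<close>

definition excess ::
  "real ^ 'n ^ 'm \<Rightarrow> real ^ 'n ^ 'n \<Rightarrow> real \<Rightarrow> real ^ 'n \<Rightarrow> real \<Rightarrow> 'n \<Rightarrow> 'm \<Rightarrow> 'n \<Rightarrow> real" where
  "excess A S c \<phi> v k i j = A $ i $ j + c * S $ k $ j + \<phi> $ j - \<phi> $ k - v"

text \<open>
  The potential terms telescope. The remaining discrepancy is the fictitious switch from the
  initial state \<open>j0\<close> at the first stage, which costs nothing in the game.
\<close>

lemma sum_excess:
  fixes A :: "real ^ 'n::finite ^ 'm::finite"
  shows "\<bar>(\<Sum>t<T. excess A S c \<phi> v (previous_column j0 (map \<omega> [0..<t])) (fst (\<omega> t)) (snd (\<omega> t))) -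
      ((\<Sum>t<T. stage_payoff A S c \<omega> t) - v * real T)\<bar> \<le> \<bar>c\<bar> * norm S + 2 * norm \<phi>"
proof -
  define k where "k t = previous_column j0 (map \<omega> [0..<t])" for t
  have k: "k 0 = j0" "k (Suc t) = snd (\<omega> t)" for t
    by (simp_all add: k_def previous_column_def)
  let ?r = "\<lambda>T. if T = 0 then 0 else c * S $ j0 $ snd (\<omega> 0)"
  have step: "excess A S c \<phi> v (k T) (fst (\<omega> T)) (snd (\<omega> T)) =
      stage_payoff A S c \<omega> T + (?r (Suc T) - ?r T) + \<phi> $ k (Suc T) - \<phi> $ k T - v" for T
    by (cases T) (simp_all add: excess_def stage_payoff_def k)
  have "(\<Sum>t<T. excess A S c \<phi> v (k t) (fst (\<omega> t)) (snd (\<omega> t))) =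
      (\<Sum>t<T. stage_payoff A S c \<omega> t) - v * real T + ?r T + \<phi> $ k T - \<phi> $ j0"
  proof (induction T)
    case 0
    then show ?case by (simp add: k)
  next
    case (Suc T)
    then show ?case
      unfolding sum.lessThan_Suc step by (simp only: of_nat_Suc distrib_left)
  qed
  moreover have "\<bar>?r T\<bar> \<le> \<bar>c\<bar> * norm S"
    using abs_cost_le[of c S] by simp
  moreover have "\<bar>\<phi> $ k T\<bar> \<le> norm \<phi>" "\<bar>\<phi> $ j0\<bar> \<le> norm \<phi>"
    by (rule component_le_norm_cart)+
  ultimately show ?thesis unfolding k_def[symmetric] by linarith
qed

lemma abs_excess_le:
  fixes A :: "real ^ 'n::finite ^ 'm::finite"
  shows "\<bar>excess A S c \<phi> v k i j\<bar> \<le> norm A + \<bar>c\<bar> * norm S + 2 * norm \<phi> + \<bar>v\<bar>"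
  using abs_entry_le_norm[of A i j] abs_cost_le[of c S k j]
    component_le_norm_cart[of \<phi> j] component_le_norm_cart[of \<phi> k]
  unfolding excess_def by linarith

text \<open>
  The sign \<open>s\<close> lets one argument serve both players: \<open>s = 1\<close> bounds the averages from below and
  \<open>s = - 1\<close> from above.
\<close>

lemma AE_average_of_excess:
  fixes A :: "real ^ 'n::finite ^ 'm::finite"
  assumes s: "s = 1 \<or> s = - 1"
    and drift: "\<And>h. 0 \<le> (\<Sum>a\<in>UNIV. pmf (\<sigma> h) (fst a) * pmf (\<tau> h) (snd a) *
      (s * excess A S c \<phi> v (previous_column j0 h) (fst a) (snd a)))"
    and "e > 0"
  shows "AE \<omega> in play_measure \<sigma> \<tau>. \<forall>\<^sub>F T in sequentially.
    s * v - e \<le> s * ((\<Sum>t<T. stage_payoff A S c \<omega> t) / real T)"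
proof -
  define K where "K = \<bar>c\<bar> * norm S + 2 * norm \<phi>"
  define X where "X \<omega> T =
    (\<Sum>t<T. excess A S c \<phi> v (previous_column j0 (map \<omega> [0..<t])) (fst (\<omega> t)) (snd (\<omega> t)))"
    for \<omega> T
  have large: "\<forall>\<^sub>F T in sequentially. 0 < T \<and> K \<le> e / 2 * real T"
  proof -
    have "\<forall>\<^sub>F T in sequentially. K / (e / 2) \<le> real T"
      using filterlim_real_sequentially by (rule filterlim_at_top[THEN iffD1, rule_format])
    with eventually_gt_at_top[of 0] show ?thesis
      by eventually_elim (use \<open>e > 0\<close> in \<open>auto simp: field_simps\<close>)
  qed
  have "AE \<omega> in play_measure \<sigma> \<tau>. \<forall>\<^sub>F T in sequentially. - (e / 2) * real T \<le>
      (\<Sum>t<T. s * excess A S c \<phi> v (previous_column j0 (map \<omega> [0..<t])) (fst (\<omega> t)) (snd (\<omega> t)))"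
  proof (rule AE_eventually_sum_ge)
    show "\<bar>s * excess A S c \<phi> v (previous_column j0 h) (fst a) (snd a)\<bar>
        \<le> norm A + \<bar>c\<bar> * norm S + 2 * norm \<phi> + \<bar>v\<bar>" for h :: "('m \<times> 'n) list" and a
      using s abs_excess_le by (auto simp: abs_mult)
  qed (use drift \<open>e > 0\<close> in auto)
  then show ?thesis
  proof eventually_elim
    case (elim \<omega>)
    then have "\<forall>\<^sub>F T in sequentially. - (e / 2) * real T \<le> s * X \<omega> T"
      by (simp add: X_def sum_distrib_left)
    then show ?case
      using large
    proof eventually_elim
      case (elim T)
      have "(s * v - e) * real T \<le> s * (\<Sum>t<T. stage_payoff A S c \<omega> t)"
        using elim s sum_excess[where A = A and S = S and c = c and \<phi> = \<phi> and v = v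
            and ?j0.0 = j0 and \<omega> = \<omega> and T = T, folded K_def X_def]
        by (auto simp: left_diff_distrib distrib_right abs_le_iff)
      then show ?case using elim by (simp add: field_simps)
    qed
  qed
qed

lemma payoff_ge_of_excess:
  fixes A :: "real ^ 'n::finite ^ 'm::finite"
  assumes "\<And>h. 0 \<le> (\<Sum>a\<in>UNIV. pmf (\<sigma> h) (fst a) * pmf (\<tau> h) (snd a) *
    excess A S c \<phi> v (previous_column j0 h) (fst a) (snd a))"
  shows "v \<le> payoff A S c \<sigma> \<tau>"
proof (rule field_le_epsilon)
  fix e :: real
  assume "e > 0"
  interpret prob_space "play_measure \<sigma> \<tau>"
    by (rule prob_space_play_measure)
  have "AE \<omega> in play_measure \<sigma> \<tau>. \<forall>\<^sub>F T in sequentially.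
      1 * v - e \<le> 1 * ((\<Sum>t<T. stage_payoff A S c \<omega> t) / real T)"
    using assms \<open>e > 0\<close>
    by (intro AE_average_of_excess[where \<phi> = \<phi> and ?j0.0 = j0]) simp_all
  then have "AE \<omega> in play_measure \<sigma> \<tau>. v - e \<le> liminf_average A S c \<omega>"
    by eventually_elim (simp add: liminf_average_ge)
  then have "v - e \<le> payoff A S c \<sigma> \<tau>"
    unfolding payoff_def by (intro integral_ge_const integrable_liminf_average)
  then show "v \<le> payoff A S c \<sigma> \<tau> + e" by simp
qed

text \<open>
  Almost surely even the limit superior of the averages is at most \<open>v\<close>.
\<close>

lemma payoff_le_of_excess:
  fixes A :: "real ^ 'n::finite ^ 'm::finite"
  assumes "\<And>h. (\<Sum>a\<in>UNIV. pmf (\<sigma> h) (fst a) * pmf (\<tau> h) (snd a) *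
    excess A S c \<phi> v (previous_column j0 h) (fst a) (snd a)) \<le> 0"
  shows "payoff A S c \<sigma> \<tau> \<le> v"
proof (rule field_le_epsilon)
  fix e :: real
  assume "e > 0"
  interpret prob_space "play_measure \<sigma> \<tau>"
    by (rule prob_space_play_measure)
  have "AE \<omega> in play_measure \<sigma> \<tau>. \<forall>\<^sub>F T in sequentially.
      - 1 * v - e \<le> - 1 * ((\<Sum>t<T. stage_payoff A S c \<omega> t) / real T)"
    using assms \<open>e > 0\<close>
    by (intro AE_average_of_excess[where \<phi> = \<phi> and ?j0.0 = j0]) (simp_all add: sum_negf)
  then have "AE \<omega> in play_measure \<sigma> \<tau>. liminf_average A S c \<omega> \<le> v + e"
  proof eventually_elim
    case (elim \<omega>)
    then have "\<forall>\<^sub>F T in sequentially. (\<Sum>t<T. stage_payoff A S c \<omega> t) / real T \<le> v + e"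
      by eventually_elim linarith
    then show ?case by (rule liminf_average_le)
  qed
  then show "payoff A S c \<sigma> \<tau> \<le> v + e"
    unfolding payoff_def by (intro integral_le_const integrable_liminf_average)
qed

text \<open>
  The players draw their actions of a stage independently, and the mean excess is linear in each
  mixed action. It is therefore enough to test the mixed action in each state against the pure
  actions of the opponent. The two players may use different potentials.
\<close>

lemma stationary_value_of_potentials:
  fixes A :: "real ^ 'n::finite ^ 'm::finite"
    and x :: "'n \<Rightarrow> 'm pmf" and y :: "'n \<Rightarrow> 'n pmf"
  assumes x: "\<And>k j. 0 \<le> (\<Sum>i\<in>UNIV. pmf (x k) i * excess A S c \<phi> v k i j)"
    and y: "\<And>k i. (\<Sum>j\<in>UNIV. pmf (y k) j * excess A S c \<psi> v k i j) \<le> 0"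
  shows "stationary_value A S c j0 v"
proof -
  let ?\<sigma> = "\<lambda>h. x (previous_column j0 h)"
  let ?\<tau> = "\<lambda>h. y (previous_column j0 h)"
  have "v \<le> payoff A S c ?\<sigma> \<tau>" for \<tau>
  proof (rule payoff_ge_of_excess)
    fix h :: "('m \<times> 'n) list"
    let ?k = "previous_column j0 h"
    have "(\<Sum>a\<in>UNIV. pmf (x ?k) (fst a) * pmf (\<tau> h) (snd a) * excess A S c \<phi> v ?k (fst a) (snd a)) =
        (\<Sum>i\<in>UNIV. \<Sum>j\<in>UNIV. pmf (x ?k) i * pmf (\<tau> h) j * excess A S c \<phi> v ?k i j)"
      by (simp add: sum.cartesian_product case_prod_beta UNIV_Times_UNIV)
    also have "\<dots> = (\<Sum>j\<in>UNIV. pmf (\<tau> h) j * (\<Sum>i\<in>UNIV. pmf (x ?k) i * excess A S c \<phi> v ?k i j))"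
      by (subst sum.swap) (simp add: sum_distrib_left mult_ac)
    also have "\<dots> \<ge> 0"
      by (intro sum_nonneg mult_nonneg_nonneg x) simp
    finally show "0 \<le> (\<Sum>a\<in>UNIV. pmf (x ?k) (fst a) * pmf (\<tau> h) (snd a) *
        excess A S c \<phi> v ?k (fst a) (snd a))" .
  qed
  moreover have "payoff A S c \<sigma> ?\<tau> \<le> v" for \<sigma>
  proof (rule payoff_le_of_excess)
    fix h :: "('m \<times> 'n) list"
    let ?k = "previous_column j0 h"
    have "(\<Sum>a\<in>UNIV. pmf (\<sigma> h) (fst a) * pmf (y ?k) (snd a) * excess A S c \<psi> v ?k (fst a) (snd a)) =
        (\<Sum>i\<in>UNIV. \<Sum>j\<in>UNIV. pmf (\<sigma> h) i * pmf (y ?k) j * excess A S c \<psi> v ?k i j)"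
      by (simp add: sum.cartesian_product case_prod_beta UNIV_Times_UNIV)
    also have "\<dots> = (\<Sum>i\<in>UNIV. pmf (\<sigma> h) i * (\<Sum>j\<in>UNIV. pmf (y ?k) j * excess A S c \<psi> v ?k i j))"
      by (simp add: sum_distrib_left mult_ac)
    also have "\<dots> \<le> 0"
      by (intro sum_nonpos mult_nonneg_nonpos y) simp
    finally show "(\<Sum>a\<in>UNIV. pmf (\<sigma> h) (fst a) * pmf (y ?k) (snd a) *
        excess A S c \<psi> v ?k (fst a) (snd a)) \<le> 0" .
  qed
  moreover have "stationary j0 ?\<sigma>" "stationary j0 ?\<tau>"
    unfolding stationary_def by (rule exI[of _ x], simp, rule exI[of _ y], simp)
  ultimately show ?thesis
    unfolding stationary_value_def by blast
qed

section \<open>Linear programming over flows\<close>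

lemma polyhedron_linear_le:
  fixes f :: "'a::euclidean_space \<Rightarrow> real"
  assumes "linear f"
  shows "polyhedron {x. f x \<le> b}"
proof -
  have "f x = adjoint f 1 \<bullet> x" for x
    using adjoint_works[OF assms, of x 1] by (simp add: inner_commute)
  then show ?thesis using polyhedron_halfspace_le[of "adjoint f 1" b] by simp
qed

lemma polyhedron_linear_eq:
  fixes f :: "'a::euclidean_space \<Rightarrow> real"
  assumes "linear f"
  shows "polyhedron {x. f x = b}"
proof -
  have "f x = adjoint f 1 \<bullet> x" for x
    using adjoint_works[OF assms, of x 1] by (simp add: inner_commute)
  then show ?thesis using polyhedron_hyperplane[of "adjoint f 1" b] by simp
qed

lemma polyhedron_Collect_all:
  fixes P :: "'i::finite \<Rightarrow> 'a::euclidean_space \<Rightarrow> bool"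
  assumes "\<And>i. polyhedron {x. P i x}"
  shows "polyhedron {x. \<forall>i. P i x}"
  unfolding Collect_all_eq using assms by (intro polyhedron_Inter) auto

lemma polyhedron_Collect_conj:
  fixes P Q :: "'a::euclidean_space \<Rightarrow> bool"
  assumes "polyhedron {x. P x}" "polyhedron {x. Q x}"
  shows "polyhedron {x. P x \<and> Q x}"
  unfolding Collect_conj_eq using assms by (rule polyhedron_Int)

lemma ex_pmf_finite:
  fixes f :: "'a::finite \<Rightarrow> real"
  assumes "\<And>i. 0 \<le> f i" "(\<Sum>i\<in>UNIV. f i) = 1"
  obtains p where "\<And>i. pmf p i = f i"
proof
  show "pmf (embed_pmf f) i = f i" for i
    using assms by (intro pmf_embed_pmf) (auto simp: nn_integral_count_space_finite)
qed

text \<open>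
  Player 2's linear program: \<open>z\<close> is a circulation of total mass \<open>1\<close> on the ordered pairs of columns
  and \<open>w\<^sub>k\<close> bounds the payoff, weighted by the mass of state \<open>k\<close>, that any row earns there. The bound
  \<open>w\<^sub>k \<le> norm A\<close> makes the set compact; the least admissible \<open>w\<close> always satisfies it.
\<close>

definition flow_polytope :: "real ^ 'n ^ 'm \<Rightarrow> ((real ^ 'n ^ 'n) \<times> (real ^ 'n)) set" where
  "flow_polytope A = {(z, w).
     (\<forall>k j. 0 \<le> z $ k $ j) \<and> (\<forall>k. (\<Sum>j\<in>UNIV. z $ k $ j) = (\<Sum>j\<in>UNIV. z $ j $ k)) \<and>
     (\<Sum>k\<in>UNIV. \<Sum>j\<in>UNIV. z $ k $ j) = 1 \<and>
     (\<forall>k i. (\<Sum>j\<in>UNIV. A $ i $ j * z $ k $ j) \<le> w $ k) \<and> (\<forall>k. w $ k \<le> norm A)}"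

definition switching_rate :: "real ^ 'n ^ 'n \<Rightarrow> real ^ 'n ^ 'n \<Rightarrow> real" where
  "switching_rate S z = (\<Sum>k\<in>UNIV. \<Sum>j\<in>UNIV. S $ k $ j * z $ k $ j)"

lemma flow_row_le_1:
  fixes z :: "real ^ 'n::finite ^ 'n"
  assumes "\<And>k j. 0 \<le> z $ k $ j" "(\<Sum>k\<in>UNIV. \<Sum>j\<in>UNIV. z $ k $ j) = 1"
  shows "(\<Sum>j\<in>UNIV. z $ k $ j) \<le> 1"
  using member_le_sum[of k UNIV "\<lambda>k. \<Sum>j\<in>UNIV. z $ k $ j"] assms by (simp add: sum_nonneg)

lemma abs_row_payoff_le:
  fixes A :: "real ^ 'n::finite ^ 'm::finite" and z :: "real ^ 'n ^ 'n"
  assumes "\<And>k j. 0 \<le> z $ k $ j" "(\<Sum>k\<in>UNIV. \<Sum>j\<in>UNIV. z $ k $ j) = 1"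
  shows "\<bar>\<Sum>j\<in>UNIV. A $ i $ j * z $ k $ j\<bar> \<le> norm A"
proof -
  have "\<bar>\<Sum>j\<in>UNIV. A $ i $ j * z $ k $ j\<bar> \<le> (\<Sum>j\<in>UNIV. norm A * z $ k $ j)"
    using assms(1)
    by (intro order.trans[OF sum_abs] sum_mono) (simp add: abs_mult abs_entry_le_norm mult_right_mono)
  also have "\<dots> = norm A * (\<Sum>j\<in>UNIV. z $ k $ j)"
    by (simp add: sum_distrib_left)
  also have "\<dots> \<le> norm A"
    using flow_row_le_1[OF assms, of k] by (simp add: mult_left_le)
  finally show ?thesis .
qed

lemma polytope_flow_polytope:
  fixes A :: "real ^ 'n::finite ^ 'm::finite"
  shows "polytope (flow_polytope A)"
  unfolding polytope_eq_bounded_polyhedron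
proof
  have "flow_polytope A = {p.
     (\<forall>k j. - (fst p $ k $ j) \<le> 0) \<and>
     (\<forall>k. (\<Sum>j\<in>UNIV. fst p $ k $ j) - (\<Sum>j\<in>UNIV. fst p $ j $ k) = 0) \<and>
     (\<Sum>k\<in>UNIV. \<Sum>j\<in>UNIV. fst p $ k $ j) = 1 \<and>
     (\<forall>k i. (\<Sum>j\<in>UNIV. A $ i $ j * fst p $ k $ j) - snd p $ k \<le> 0) \<and>
     (\<forall>k. snd p $ k \<le> norm A)}"
    by (auto simp: flow_polytope_def)
  also have "polyhedron \<dots>"
    by (intro polyhedron_Collect_conj polyhedron_Collect_all polyhedron_linear_le
        polyhedron_linear_eq linearI)
      (simp_all add: sum.distrib sum_distrib_left algebra_simps)
  finally show "polyhedron (flow_polytope A)" .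
  show "bounded (flow_polytope A)"
  proof (rule boundedI)
    fix p
    assume p: "p \<in> flow_polytope A"
    obtain z w where zw: "p = (z, w)" by (cases p)
    have z: "\<And>k j. 0 \<le> z $ k $ j" "(\<Sum>k\<in>UNIV. \<Sum>j\<in>UNIV. z $ k $ j) = 1"
      and w: "\<And>k i. (\<Sum>j\<in>UNIV. A $ i $ j * z $ k $ j) \<le> w $ k" "\<And>k. w $ k \<le> norm A"
      using p by (auto simp: flow_polytope_def zw)
    have "\<bar>w $ k\<bar> \<le> norm A" for k
      using abs_row_payoff_le[OF z, of A undefined k] w(1)[where i = undefined and k = k] w(2)[of k]
      by linarith
    then have "norm w \<le> (\<Sum>k\<in>(UNIV :: 'n set). norm A)"
      by (intro order.trans[OF norm_le_l1_cart] sum_mono)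
    moreover have "norm z \<le> (\<Sum>k\<in>UNIV. \<Sum>j\<in>UNIV. \<bar>z $ k $ j\<bar>)"
      unfolding norm_vec_def[of z]
      by (intro order.trans[OF L2_set_le_sum] sum_mono norm_le_l1_cart) simp
    moreover have "(\<Sum>k\<in>UNIV. \<Sum>j\<in>UNIV. \<bar>z $ k $ j\<bar>) = 1"
      using z by simp
    ultimately show "norm p \<le> 1 + (\<Sum>k\<in>(UNIV :: 'n set). norm A)"
      using norm_Pair_le[of z w] unfolding zw by linarith
  qed
qed

lemma flow_polytope_nonempty:
  fixes A :: "real ^ 'n::finite ^ 'm::finite"
  shows "flow_polytope A \<noteq> {}"
proof -
  define j0 :: 'n where "j0 = undefined"
  define z :: "real ^ 'n ^ 'n" where "z = (\<chi> k j. if k = j0 \<and> j = j0 then 1 else 0)"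
  have row: "(\<Sum>j\<in>UNIV. z $ k $ j) = (if k = j0 then 1 else 0)" for k
    by (cases "k = j0") (simp_all add: z_def)
  moreover have "(\<Sum>j\<in>UNIV. z $ j $ k) = (if k = j0 then 1 else 0)" for k
    by (cases "k = j0") (simp_all add: z_def)
  moreover have "0 \<le> z $ k $ j" for k j
    by (simp add: z_def)
  moreover have "(\<Sum>k\<in>UNIV. \<Sum>j\<in>UNIV. z $ k $ j) = 1"
    by (simp add: row)
  moreover have "(\<Sum>j\<in>UNIV. A $ i $ j * z $ k $ j) \<le> norm A" for i k
    using abs_row_payoff_le[of z A i k] calculation by (simp add: abs_le_iff)
  ultimately have "(z, \<chi> k. norm A) \<in> flow_polytope A"
    by (simp add: flow_polytope_def)
  then show ?thesis by blast
qed

text \<open>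
  Normalizing a circulation and letting Player 1 reply optimally in each state (with row \<open>f k\<close>)
  gives the point of the polytope with the least \<open>w\<close>.
\<close>

lemma flow_of_circulation:
  fixes A :: "real ^ 'n::finite ^ 'm::finite" and a :: "real ^ 'n ^ 'n"
  assumes a: "\<And>k j. 0 \<le> a $ k $ j" "\<And>k. (\<Sum>j\<in>UNIV. a $ k $ j) = (\<Sum>j\<in>UNIV. a $ j $ k)"
    and "a \<noteq> 0"
  obtains N z w f where "0 < N" "a = N *\<^sub>R z" "(z, w) \<in> flow_polytope A"
    "\<And>k. w $ k = (\<Sum>j\<in>UNIV. A $ f k $ j * z $ k $ j)"
proof -
  define N where "N = (\<Sum>k\<in>UNIV. \<Sum>j\<in>UNIV. a $ k $ j)"
  have "0 \<le> N" unfolding N_def by (intro sum_nonneg a)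
  moreover have "N \<noteq> 0"
  proof
    assume "N = 0"
    then have "a $ k $ j = 0" for k j
      using a(1) by (simp add: N_def sum_nonneg_eq_0_iff sum_nonneg)
    then show False using \<open>a \<noteq> 0\<close> by (simp add: vec_eq_iff)
  qed
  ultimately have N: "0 < N" by simp
  define z where "z = a /\<^sub>R N"
  have z: "\<And>k j. 0 \<le> z $ k $ j" "\<And>k. (\<Sum>j\<in>UNIV. z $ k $ j) = (\<Sum>j\<in>UNIV. z $ j $ k)"
    using a N by (simp_all add: z_def sum_distrib_left[symmetric])
  have z1: "(\<Sum>k\<in>UNIV. \<Sum>j\<in>UNIV. z $ k $ j) = 1"
    using N by (simp add: z_def sum_distrib_left[symmetric] N_def[symmetric])
  have "\<exists>i. \<forall>i'. (\<Sum>j\<in>UNIV. A $ i' $ j * z $ k $ j) \<le> (\<Sum>j\<in>UNIV. A $ i $ j * z $ k $ j)" for k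
  proof -
    let ?P = "\<lambda>i. \<Sum>j\<in>UNIV. A $ i $ j * z $ k $ j"
    have "Max (range ?P) \<in> range ?P" by (intro Max_in) auto
    then obtain i where i: "Max (range ?P) = ?P i" by blast
    have "?P i' \<le> ?P i" for i' unfolding i[symmetric] by (intro Max_ge) auto
    then show ?thesis by blast
  qed
  then obtain f where f: "\<And>k i'. (\<Sum>j\<in>UNIV. A $ i' $ j * z $ k $ j) \<le> (\<Sum>j\<in>UNIV. A $ f k $ j * z $ k $ j)"
    by metis
  define w where "w = (\<chi> k. \<Sum>j\<in>UNIV. A $ f k $ j * z $ k $ j)"
  have "w $ k \<le> norm A" for k
    using abs_row_payoff_le[OF z(1) z1, of A "f k" k] by (simp add: w_def abs_le_iff)
  then have "(z, w) \<in> flow_polytope A"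
    using z z1 f by (simp add: flow_polytope_def w_def)
  then show ?thesis
    using that[of N z w f] N by (simp add: z_def w_def)
qed

text \<open>
  A theorem of the alternative on the complete digraph. The matrices that become nonnegative after
  adding a potential difference form the convex cone generated by the potential differences and the
  nonnegative matrices. As it is finitely generated, it is closed, so it either meets the compact
  set \<open>K\<close> or can be separated strictly from it. The functional that separates them is nonnegative
  on the cone, hence vanishes on potential differences: it is a circulation.
\<close>

lemma potential_or_circulation:
  fixes K :: "(real ^ 'n::finite ^ 'n) set"
  assumes K: "convex K" "compact K" "K \<noteq> {}"
  obtains (potential) q \<phi> where "q \<in> K" "\<And>k j. 0 \<le> q $ k $ j + \<phi> $ j - \<phi> $ k"
  | (circulation) a where "\<And>k j. 0 \<le> a $ k $ j"
    "\<And>k. (\<Sum>j\<in>UNIV. a $ k $ j) = (\<Sum>j\<in>UNIV. a $ j $ k)" "\<And>q. q \<in> K \<Longrightarrow> a \<bullet> q < 0"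
proof -
  define d :: "'n \<Rightarrow> real ^ 'n ^ 'n" where
    "d l = (\<chi> k j. (if j = l then 1 else 0) - (if k = l then 1 else 0))" for l
  define E :: "'n \<times> 'n \<Rightarrow> real ^ 'n ^ 'n" where "E = (\<lambda>(k, j). axis k (axis j 1))"
  define G where "G = range d \<union> range (\<lambda>l. - d l) \<union> range E"
  define L where "L = convex_cone hull G"
  have "finite G" by (simp add: G_def)
  then have L: "convex L" "closed L"
    unfolding L_def by (simp_all add: closed_convex_cone_hull convex_convex_cone_hull)
  have inner_d: "a \<bullet> d l = (\<Sum>k\<in>UNIV. a $ k $ l) - (\<Sum>j\<in>UNIV. a $ l $ j)" for a l
  proof -
    have "a \<bullet> d l = (\<Sum>k\<in>UNIV. \<Sum>j\<in>UNIV. (if j = l then a $ k $ j else 0) - (if k = l then a $ k $ j else 0))"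
      unfolding inner_vec_def d_def by (intro sum.cong refl) (auto simp: algebra_simps)
    also have "\<dots> = (\<Sum>k\<in>UNIV. a $ k $ l) - (\<Sum>k\<in>UNIV. \<Sum>j\<in>UNIV. if k = l then a $ k $ j else 0)"
      by (simp add: sum_subtractf)
    also have "(\<Sum>k\<in>UNIV. \<Sum>j\<in>UNIV. if k = l then a $ k $ j else 0) =
        (\<Sum>k\<in>UNIV. if k = l then \<Sum>j\<in>UNIV. a $ k $ j else 0)"
      by (intro sum.cong) auto
    finally show ?thesis by simp
  qed
  have inner_E: "a \<bullet> E (k, j) = a $ k $ j" for a k j
    by (simp add: E_def inner_axis)
  show ?thesis
  proof (cases "K \<inter> L = {}")
    case False
    then obtain q where q: "q \<in> K" "q \<in> L" by blast
    let ?P = "{q. \<exists>\<phi> :: real ^ 'n. \<forall>k j. 0 \<le> q $ k $ j + \<phi> $ j - \<phi> $ k}"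
    have "L \<subseteq> ?P"
      unfolding L_def
    proof (rule hull_minimal)
      show "G \<subseteq> ?P"
      proof
        fix g
        assume "g \<in> G"
        then consider l where "g = d l" | l where "g = - d l" | k j where "g = E (k, j)"
          unfolding G_def by auto
        then show "g \<in> ?P"
        proof cases
          case 1
          then show ?thesis
            by (auto simp: d_def intro!: exI[of _ "- axis l 1"]) (auto simp: axis_def)
        next
          case 2
          then show ?thesis
            by (auto simp: d_def intro!: exI[of _ "axis l 1"]) (auto simp: axis_def)
        next
          case 3
          then show ?thesis
            by (auto simp: E_def axis_def intro!: exI[of _ 0])
        qed
      qed
      show "convex_cone ?P"
        unfolding convex_cone_iff
      proof (intro conjI ballI allI impI)
        show "0 \<in> ?P" by (auto intro!: exI[of _ 0])
      next
        fix x y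
        assume "x \<in> ?P" "y \<in> ?P"
        then obtain \<phi> \<psi> :: "real ^ 'n"
          where \<phi>: "\<And>k j. 0 \<le> x $ k $ j + \<phi> $ j - \<phi> $ k" "\<And>k j. 0 \<le> y $ k $ j + \<psi> $ j - \<psi> $ k"
          by blast
        have "0 \<le> (x + y) $ k $ j + (\<phi> + \<psi>) $ j - (\<phi> + \<psi>) $ k" for k j
          using \<phi>[of k j] by simp
        then show "x + y \<in> ?P" by blast
      next
        fix x and t :: real
        assume "x \<in> ?P" "0 \<le> t"
        then obtain \<phi> :: "real ^ 'n" where \<phi>: "\<And>k j. 0 \<le> x $ k $ j + \<phi> $ j - \<phi> $ k"
          by blast
        have "0 \<le> (t *\<^sub>R x) $ k $ j + (t *\<^sub>R \<phi>) $ j - (t *\<^sub>R \<phi>) $ k" for k j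
          using mult_nonneg_nonneg[OF \<open>0 \<le> t\<close> \<phi>[of k j]] by (simp add: algebra_simps)
        then show "t *\<^sub>R x \<in> ?P" by blast
      qed
    qed
    with q potential show ?thesis by blast
  next
    case True
    then obtain a b where ab: "\<And>q. q \<in> K \<Longrightarrow> a \<bullet> q < b" "\<And>g. g \<in> L \<Longrightarrow> b < a \<bullet> g"
      using separating_hyperplane_compact_closed[OF K L] by blast
    have "0 \<in> L" unfolding L_def by (rule convex_cone_hull_contains_0)
    with ab(2) have "b < 0" by fastforce
    \<comment> \<open>a negative value could be scaled to the value \<open>b\<close>, which elements of \<open>L\<close> exceed\<close>
    have G: "0 \<le> a \<bullet> g" if "g \<in> G" for g
    proof (rule ccontr)
      assume neg: "\<not> 0 \<le> a \<bullet> g"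
      have "g \<in> L" using that unfolding L_def by (rule hull_inc)
      then have "(b / (a \<bullet> g)) *\<^sub>R g \<in> L"
        using neg \<open>b < 0\<close> unfolding L_def
        by (intro convex_cone_scaleR convex_cone_convex_cone_hull) (auto simp: divide_nonpos_nonpos)
      with ab(2) have "b < a \<bullet> ((b / (a \<bullet> g)) *\<^sub>R g)" by blast
      then show False using neg by simp
    qed
    show ?thesis
    proof (rule circulation)
      fix k j
      show "0 \<le> a $ k $ j"
        using G[of "E (k, j)"] by (simp add: inner_E G_def)
      show "(\<Sum>j\<in>UNIV. a $ k $ j) = (\<Sum>j\<in>UNIV. a $ j $ k)"
        using G[of "d k"] G[of "- d k"] by (simp add: inner_d G_def)
    next
      fix q
      assume "q \<in> K"
      then show "a \<bullet> q < 0" using ab(1) \<open>b < 0\<close> by fastforce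
    qed
  qed
qed

text \<open>
  Strong duality. \<open>Q\<close> collects the mean one-stage payoffs, reduced by \<open>v\<close>, of all stationary
  strategies of Player 1. It contains the polytope spanned by the pure ones. If no strategy
  admitted a suitable potential, there would be a circulation on which every pure strategy earns
  less than \<open>v\<close>, and the best reply to it would contradict the assumed lower bound \<open>v\<close> on the cost
  of flows.
\<close>

lemma ex_optimal_potential:
  fixes A :: "real ^ 'n::finite ^ 'm::finite"
  assumes lower: "\<And>z w. (z, w) \<in> flow_polytope A \<Longrightarrow> v \<le> (\<Sum>k\<in>UNIV. w $ k) + c * switching_rate S z"
  obtains x :: "'n \<Rightarrow> 'm pmf" and \<phi> where
    "\<And>k j. 0 \<le> (\<Sum>i\<in>UNIV. pmf (x k) i * excess A S c \<phi> v k i j)"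
proof -
  define pure :: "('n \<Rightarrow> 'm) \<Rightarrow> real ^ 'n ^ 'n" where
    "pure f = (\<chi> k j. A $ f k $ j + c * S $ k $ j - v)" for f
  define Q where "Q = {q. \<exists>x. (\<forall>k i. 0 \<le> x k i) \<and> (\<forall>k. (\<Sum>i\<in>UNIV. x k i) = 1) \<and>
    (\<forall>k j. q $ k $ j = (\<Sum>i\<in>UNIV. x k i * (A $ i $ j + c * S $ k $ j - v)))}"
  have "convex Q"
  proof (rule convexI)
    fix q q' and u t :: real
    assume "q \<in> Q" "q' \<in> Q" and ut: "0 \<le> u" "0 \<le> t" "u + t = 1"
    then obtain x x' where
      x: "\<And>k i. 0 \<le> x k i" "\<And>k. (\<Sum>i\<in>UNIV. x k i) = 1"
        "\<And>k j. q $ k $ j = (\<Sum>i\<in>UNIV. x k i * (A $ i $ j + c * S $ k $ j - v))" and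
      x': "\<And>k i. 0 \<le> x' k i" "\<And>k. (\<Sum>i\<in>UNIV. x' k i) = 1"
        "\<And>k j. q' $ k $ j = (\<Sum>i\<in>UNIV. x' k i * (A $ i $ j + c * S $ k $ j - v))"
      unfolding Q_def by blast
    have "(u *\<^sub>R q + t *\<^sub>R q') $ k $ j =
        (\<Sum>i\<in>UNIV. (u * x k i + t * x' k i) * (A $ i $ j + c * S $ k $ j - v))" for k j
      by (simp add: x(3) x'(3) sum_distrib_left sum.distrib[symmetric] distrib_right mult.assoc)
    moreover have "(\<Sum>i\<in>UNIV. u * x k i + t * x' k i) = 1" for k
      using ut by (simp add: sum.distrib sum_distrib_left[symmetric] x(2) x'(2))
    ultimately show "u *\<^sub>R q + t *\<^sub>R q' \<in> Q"
      unfolding Q_def using x(1) x'(1) ut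
      by (intro CollectI exI[of _ "\<lambda>k i. u * x k i + t * x' k i"]) simp
  qed
  moreover have "pure f \<in> Q" for f
  proof -
    have "(\<Sum>i\<in>UNIV. (if i = l then 1 else 0) * g i) = g l" for g :: "'m \<Rightarrow> real" and l
    proof -
      have "(\<Sum>i\<in>UNIV. (if i = l then 1 else 0) * g i) = (\<Sum>i\<in>UNIV. if i = l then g i else 0)"
        by (intro sum.cong) auto
      then show ?thesis by simp
    qed
    then show ?thesis
      unfolding Q_def pure_def
    by (intro CollectI exI[of _ "\<lambda>k i. if i = f k then 1 else 0"]) simp
  qed
  ultimately have hull: "convex hull (range pure) \<subseteq> Q"
    by (intro hull_minimal) auto
  have K: "convex (convex hull (range pure))" "compact (convex hull (range pure))"
    "convex hull (range pure) \<noteq> {}"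
    by (auto intro: finite_imp_compact_convex_hull)
  show ?thesis
  proof (rule potential_or_circulation[OF K])
    fix q and \<phi> :: "real ^ 'n"
    assume "q \<in> convex hull (range pure)" and pot: "\<And>k j. 0 \<le> q $ k $ j + \<phi> $ j - \<phi> $ k"
    then obtain x where x: "\<And>k i. 0 \<le> x k i" "\<And>k. (\<Sum>i\<in>UNIV. x k i) = 1"
        and q: "\<And>k j. q $ k $ j = (\<Sum>i\<in>UNIV. x k i * (A $ i $ j + c * S $ k $ j - v))"
      using hull unfolding Q_def by blast
    have "\<exists>p. \<forall>i. pmf p i = x k i" for k
      by (rule ex_pmf_finite[OF x(1) x(2)]) blast
    then obtain p where p: "\<And>k i. pmf (p k) i = x k i" by metis
    have "(\<Sum>i\<in>UNIV. x k i * excess A S c \<phi> v k i j) = q $ k $ j + \<phi> $ j - \<phi> $ k" for k j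
    proof -
      have "(\<Sum>i\<in>UNIV. x k i * excess A S c \<phi> v k i j) =
          q $ k $ j + (\<phi> $ j - \<phi> $ k) * (\<Sum>i\<in>UNIV. x k i)"
        unfolding q sum_distrib_left sum.distrib[symmetric]
        by (intro sum.cong refl) (simp add: excess_def algebra_simps)
      then show ?thesis by (simp add: x(2))
    qed
    then show thesis
      using pot that[of p \<phi>] by (simp add: p)
  next
    fix a
    assume a: "\<And>k j. 0 \<le> a $ k $ j" "\<And>k. (\<Sum>j\<in>UNIV. a $ k $ j) = (\<Sum>j\<in>UNIV. a $ j $ k)"
      and neg: "\<And>q. q \<in> convex hull (range pure) \<Longrightarrow> a \<bullet> q < 0"
    have "a \<noteq> 0" using neg[of "pure undefined"] by (auto simp: hull_inc)
    obtain N z w f where N: "0 < N" "a = N *\<^sub>R z" and zw: "(z, w) \<in> flow_polytope A"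
      and w: "\<And>k. w $ k = (\<Sum>j\<in>UNIV. A $ f k $ j * z $ k $ j)"
      by (rule flow_of_circulation[OF a \<open>a \<noteq> 0\<close>, where A = A]) (rule that)
    have total: "(\<Sum>k\<in>UNIV. \<Sum>j\<in>UNIV. z $ k $ j) = 1"
      using zw by (auto simp: flow_polytope_def)
    have "z \<bullet> pure f = (\<Sum>k\<in>UNIV. \<Sum>j\<in>UNIV.
        A $ f k $ j * z $ k $ j + c * (S $ k $ j * z $ k $ j) - v * z $ k $ j)"
      unfolding inner_vec_def pure_def by (intro sum.cong refl) (simp add: inner_vec_def algebra_simps)
    also have "\<dots> = (\<Sum>k\<in>UNIV. w $ k) + c * switching_rate S z - v * (\<Sum>k\<in>UNIV. \<Sum>j\<in>UNIV. z $ k $ j)"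
      by (simp add: sum_subtractf sum.distrib sum_distrib_left switching_rate_def w)
    also have "\<dots> = (\<Sum>k\<in>UNIV. w $ k) + c * switching_rate S z - v"
      using total by simp
    also have "\<dots> \<ge> 0"
      using lower[OF zw] by simp
    finally have "0 \<le> a \<bullet> pure f"
      using N by simp
    moreover have "a \<bullet> pure f < 0"
      by (intro neg hull_inc) simp
    ultimately show thesis by simp
  qed
qed

text \<open>
  Complementary slackness. \<open>G k\<close> bounds from above the excess in state \<open>k\<close>, weighted by the flow,
  of every row. It is nonnegative because \<open>x\<close> and \<open>\<phi>\<close> are feasible for Player 1, and the \<open>G k\<close>
  add up to the cost of the flow minus \<open>v\<close>, which is zero. Hence each \<open>G k\<close> vanishes, and \<open>\<phi>\<close>
  certifies the strategy of Player 2 on all states of positive mass \<open>s k\<close>, even if these split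
  into several recurrent classes. Play never leaves them, since by balance the flow out of
  a state enters states of positive mass.
\<close>

lemma stationary_value_of_optimal_flow:
  fixes A :: "real ^ 'n::finite ^ 'm::finite"
  assumes zw: "(z, w) \<in> flow_polytope A"
    and v: "v = (\<Sum>k\<in>UNIV. w $ k) + c * switching_rate S z"
    and lower: "\<And>z w. (z, w) \<in> flow_polytope A \<Longrightarrow> v \<le> (\<Sum>k\<in>UNIV. w $ k) + c * switching_rate S z"
  shows "stationary_value A S c j0 v"
proof -
  have z: "\<And>k j. 0 \<le> z $ k $ j" "\<And>k. (\<Sum>j\<in>UNIV. z $ k $ j) = (\<Sum>j\<in>UNIV. z $ j $ k)"
    "(\<Sum>k\<in>UNIV. \<Sum>j\<in>UNIV. z $ k $ j) = 1"
    and w: "\<And>k i. (\<Sum>j\<in>UNIV. A $ i $ j * z $ k $ j) \<le> w $ k"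
    using zw by (auto simp: flow_polytope_def)
  obtain x :: "'n \<Rightarrow> 'm pmf" and \<phi> where
    x: "\<And>k j. 0 \<le> (\<Sum>i\<in>UNIV. pmf (x k) i * excess A S c \<phi> v k i j)"
    using ex_optimal_potential[OF lower] by blast
  define R where "R k j = c * S $ k $ j + \<phi> $ j - \<phi> $ k - v" for k j
  have excess: "excess A S c \<phi> v k i j = A $ i $ j + R k j" for k i j
    by (simp add: excess_def R_def)
  define G where "G k = w $ k + (\<Sum>j\<in>UNIV. z $ k $ j * R k j)" for k
  have row_le: "(\<Sum>j\<in>UNIV. z $ k $ j * excess A S c \<phi> v k i j) \<le> G k" for k i
    using w[of i k] by (simp add: excess G_def distrib_left sum.distrib mult.commute)
  have "0 \<le> G k" for k
  proof -
    have "0 \<le> (\<Sum>j\<in>UNIV. z $ k $ j * (\<Sum>i\<in>UNIV. pmf (x k) i * excess A S c \<phi> v k i j))"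
      by (intro sum_nonneg mult_nonneg_nonneg z x)
    also have "\<dots> = (\<Sum>i\<in>UNIV. pmf (x k) i * (\<Sum>j\<in>UNIV. z $ k $ j * excess A S c \<phi> v k i j))"
      unfolding sum_distrib_left by (subst sum.swap) (simp add: mult_ac)
    also have "\<dots> \<le> (\<Sum>i\<in>UNIV. pmf (x k) i * G k)"
      by (intro sum_mono mult_left_mono row_le) simp
    also have "\<dots> = G k"
      by (simp add: sum_distrib_right[symmetric] sum_pmf_eq_1)
    finally show ?thesis .
  qed
  moreover have "(\<Sum>k\<in>UNIV. G k) = 0"
  proof -
    have "(\<Sum>k\<in>UNIV. \<Sum>j\<in>UNIV. z $ k $ j * \<phi> $ k) = (\<Sum>k\<in>UNIV. (\<Sum>j\<in>UNIV. z $ k $ j) * \<phi> $ k)"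
      by (simp add: sum_distrib_right)
    also have "\<dots> = (\<Sum>k\<in>UNIV. \<Sum>j\<in>UNIV. z $ j $ k * \<phi> $ k)"
      unfolding z(2) by (simp add: sum_distrib_right)
    also have "\<dots> = (\<Sum>k\<in>UNIV. \<Sum>j\<in>UNIV. z $ k $ j * \<phi> $ j)"
      by (rule sum.swap)
    finally have balance: "(\<Sum>k\<in>UNIV. \<Sum>j\<in>UNIV. z $ k $ j * \<phi> $ k) =
      (\<Sum>k\<in>UNIV. \<Sum>j\<in>UNIV. z $ k $ j * \<phi> $ j)" .
    have "(\<Sum>k\<in>UNIV. G k) = (\<Sum>k\<in>UNIV. w $ k) + (\<Sum>k\<in>UNIV. \<Sum>j\<in>UNIV.
        c * (S $ k $ j * z $ k $ j) + z $ k $ j * \<phi> $ j - z $ k $ j * \<phi> $ k - v * z $ k $ j)"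
      unfolding G_def sum.distrib R_def by (simp add: algebra_simps)
    also have "\<dots> = (\<Sum>k\<in>UNIV. w $ k) + c * switching_rate S z - v * (\<Sum>k\<in>UNIV. \<Sum>j\<in>UNIV. z $ k $ j)"
      by (simp add: sum_subtractf sum.distrib sum_distrib_left switching_rate_def balance)
    finally show ?thesis using v z(3) by simp
  qed
  ultimately have "G k = 0" for k
    by (simp add: sum_nonneg_eq_0_iff)
  with row_le have flow_le: "(\<Sum>j\<in>UNIV. z $ k $ j * excess A S c \<phi> v k i j) \<le> 0" for k i
    by metis
  define s where "s k = (\<Sum>j\<in>UNIV. z $ k $ j)" for k
  have s: "0 \<le> s k" for k unfolding s_def by (intro sum_nonneg z)
  have "\<exists>k. s k \<noteq> 0"
  proof (rule ccontr)
    assume "\<not> ?thesis"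
    then show False using z(3) by (simp add: s_def)
  qed
  then obtain r where r: "s r \<noteq> 0" by blast
  have "\<exists>p. \<forall>j. pmf p j = (if s k = 0 then if j = r then 1 else 0 else z $ k $ j / s k)" for k
  proof (rule ex_pmf_finite)
    show "0 \<le> (if s k = 0 then if j = r then 1 else 0 else z $ k $ j / s k)" for j
      using z s by simp
    show "(\<Sum>j\<in>UNIV. if s k = 0 then if j = r then 1 else 0 else z $ k $ j / s k) = 1"
      by (cases "s k = 0") (simp_all add: sum_divide_distrib[symmetric] s_def[symmetric])
  qed blast
  then obtain y where y: "\<And>k j. pmf (y k) j = (if s k = 0 then if j = r then 1 else 0 else z $ k $ j / s k)"
    by metis
  \<comment> \<open>the move from a state without flow to \<open>r\<close> pays at most \<open>norm A + \<bar>c\<bar> * norm S\<close>\<close>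
  define \<psi> :: "real ^ 'n" where
    "\<psi> = (\<chi> k. if s k = 0 then norm A + \<bar>c\<bar> * norm S + \<phi> $ r - v else \<phi> $ k)"
  have "(\<Sum>j\<in>UNIV. pmf (y k) j * excess A S c \<psi> v k i j) \<le> 0" for k i
  proof (cases "s k = 0")
    case True
    then have "(\<Sum>j\<in>UNIV. pmf (y k) j * excess A S c \<psi> v k i j) =
        (\<Sum>j\<in>UNIV. if j = r then excess A S c \<psi> v k i j else 0)"
      by (intro sum.cong) (simp_all add: y)
    also have "\<dots> = A $ i $ r + c * S $ k $ r - (norm A + \<bar>c\<bar> * norm S)"
      using True r by (simp add: excess_def \<psi>_def)
    also have "\<dots> \<le> 0"
      using abs_entry_le_norm[of A i r] abs_cost_le[of c S k r] by linarith
    finally show ?thesis .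
  next
    case False
    have "pmf (y k) j * excess A S c \<psi> v k i j = z $ k $ j * excess A S c \<phi> v k i j / s k" for j
    proof (cases "z $ k $ j = 0")
      case True
      then show ?thesis using False by (simp add: y)
    next
      case nz: False
      have "z $ k $ j \<le> s j"
        unfolding s_def z(2) using z(1) by (intro member_le_sum) auto
      then have "s j \<noteq> 0" using nz z(1)[of k j] by linarith
      then show ?thesis using False by (simp add: y excess_def \<psi>_def)
    qed
    then have "(\<Sum>j\<in>UNIV. pmf (y k) j * excess A S c \<psi> v k i j) =
        (\<Sum>j\<in>UNIV. z $ k $ j * excess A S c \<phi> v k i j) / s k"
      by (simp add: sum_divide_distrib)
    also have "\<dots> \<le> 0"
      using flow_le s by (simp add: divide_nonpos_nonneg)
    finally show ?thesis .
  qed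
  with x show ?thesis by (rule stationary_value_of_potentials)
qed

section \<open>Minima of finitely many affine functions\<close>

definition affine_min :: "(real \<times> real) set \<Rightarrow> real \<Rightarrow> real" where
  "affine_min F c = Min ((\<lambda>(p, q). p * c + q) ` F)"

lemma affine_min_le: "finite F \<Longrightarrow> (p, q) \<in> F \<Longrightarrow> affine_min F c \<le> p * c + q"
  unfolding affine_min_def by (intro Min_le) force+

lemma affine_min_attained:
  assumes "finite F" "F \<noteq> {}"
  obtains p q where "(p, q) \<in> F" "affine_min F c = p * c + q"
proof -
  have "affine_min F c \<in> (\<lambda>(p, q). p * c + q) ` F"
    unfolding affine_min_def using assms by (intro Min_in) auto
  then show ?thesis using that by auto
qed

lemma concave_affine_min:
  assumes "finite F" "F \<noteq> {}"
  shows "concave_on UNIV (affine_min F)"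
  unfolding concave_on_iff
proof (intro conjI ballI allI impI)
  fix x y u v :: real
  assume uv: "0 \<le> u" "0 \<le> v" "u + v = 1"
  obtain p q where F: "(p, q) \<in> F" and eq: "affine_min F (u * x + v * y) = p * (u * x + v * y) + q"
    using affine_min_attained[OF assms] by blast
  have "u * affine_min F x + v * affine_min F y \<le> u * (p * x + q) + v * (p * y + q)"
    using assms F uv by (intro add_mono mult_left_mono affine_min_le) auto
  also have "\<dots> = p * (u * x + v * y) + (u + v) * q"
    by (simp add: algebra_simps)
  finally show "u * affine_min F x + v * affine_min F y \<le> affine_min F (u *\<^sub>R x + v *\<^sub>R y)"
    using uv eq by simp
qed simp

lemma continuous_affine_min:
  assumes "finite F" "F \<noteq> {}"
  shows "continuous_on UNIV (affine_min F)"
proof -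
  have "continuous_on UNIV (\<lambda>x. - affine_min F x)"
    using concave_affine_min[OF assms] unfolding concave_on_def by (intro convex_on_continuous) auto
  then show ?thesis
    by (auto dest: continuous_on_minus)
qed

lemma mono_affine_min:
  assumes "finite F" "F \<noteq> {}" and slope: "\<And>p q. (p, q) \<in> F \<Longrightarrow> 0 \<le> p"
  shows "mono (affine_min F)"
proof (rule monoI)
  fix x y :: real
  assume "x \<le> y"
  obtain p q where F: "(p, q) \<in> F" and eq: "affine_min F y = p * y + q"
    using affine_min_attained[OF assms(1,2)] by blast
  have "affine_min F x \<le> p * x + q"
    using assms(1) F by (rule affine_min_le)
  also have "\<dots> \<le> p * y + q"
    using slope[OF F] \<open>x \<le> y\<close> by (simp add: mult_left_mono)
  finally show "affine_min F x \<le> affine_min F y"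
    by (simp add: eq)
qed

text \<open>
  The function that attains the minimum at an interior point \<open>m\<close> attains it on all of \<open>I\<close>: if
  another one were smaller somewhere in \<open>I\<close>, the two graphs would cross in the interior of \<open>I\<close>.
\<close>

lemma affine_on_affine_min:
  assumes F: "finite F" "F \<noteq> {}" and m: "m \<in> interior I" and "convex I"
    and cross: "\<And>p q p' q'. (p, q) \<in> F \<Longrightarrow> (p', q') \<in> F \<Longrightarrow> p \<noteq> p' \<Longrightarrow>
      (q' - q) / (p - p') \<notin> interior I"
  shows "affine_on I (affine_min F)"
proof -
  obtain p q where pq: "(p, q) \<in> F" and m_eq: "affine_min F m = p * m + q"
    using affine_min_attained[OF F] by blast
  have le: "p * x + q \<le> p' * x + q'" if "x \<in> I" and pq': "(p', q') \<in> F" for x p' q'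
  proof (rule ccontr)
    assume less: "\<not> p * x + q \<le> p' * x + q'"
    have at_m: "p * m + q \<le> p' * m + q'"
      using affine_min_le[OF F(1) pq', of m] m_eq by simp
    have ne: "p \<noteq> p'" using less at_m by auto
    define r where "r = (q' - q) / (p - p')"
    have r: "(p - p') * r = q' - q" using ne by (simp add: r_def)
    have m_le: "(p - p') * m \<le> (p - p') * r" and x_gt: "(p - p') * r < (p - p') * x"
      using less at_m r by (auto simp: algebra_simps)
    have "r \<in> insert m (open_segment m x)"
    proof (cases "p' < p")
      case True
      then have "m \<le> r" "r < x" using m_le x_gt by auto
      then show ?thesis by (auto simp: open_segment_eq_real_ivl)
    next
      case False
      then have "r \<le> m" "x < r" using ne m_le x_gt by (auto simp: mult_less_cancel_left mult_le_cancel_left)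
      then show ?thesis by (auto simp: open_segment_eq_real_ivl)
    qed
    moreover have "open_segment m x \<subseteq> interior I"
    proof -
      have "x \<in> closure I" using \<open>x \<in> I\<close> closure_subset by blast
      then show ?thesis using in_interior_closure_convex_segment[OF \<open>convex I\<close> m] by simp
    qed
    ultimately have "r \<in> interior I" using m by auto
    then show False using cross[OF pq pq' ne] by (simp add: r_def)
  qed
  have "affine_min F x = p * x + q" if "x \<in> I" for x
  proof (rule antisym)
    show "affine_min F x \<le> p * x + q" using F(1) pq by (rule affine_min_le)
    obtain p' q' where "(p', q') \<in> F" "affine_min F x = p' * x + q'"
      using affine_min_attained[OF F] by blast
    then show "p * x + q \<le> affine_min F x" using le[OF that] by simp
  qed
  then show ?thesis unfolding affine_on_def by blast
qed

text \<open>
  The breakpoints are \<open>0\<close> and the positive abscissae at which two of the graphs cross.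
\<close>

lemma finitely_piecewise_linear_affine_min:
  assumes F: "finite F" "F \<noteq> {}"
  shows "finitely_piecewise_linear (affine_min F)"
proof -
  let ?cross = "\<lambda>((p, q), (p', q')). (q' - q) / (p - p') :: real"
  define B where "B = insert 0 {r \<in> ?cross ` (F \<times> F). 0 < r}"
  have "finite B" using F by (simp add: B_def)
  define xs where "xs = sorted_list_of_set B"
  have xs: "sorted_wrt (<) xs" "set xs = B"
    using \<open>finite B\<close> by (simp_all add: xs_def)
  have "xs \<noteq> []" using xs(2) by (auto simp: B_def)
  define r where "r = length xs - 1"
  have len: "length xs = Suc r" using \<open>xs \<noteq> []\<close> by (simp add: r_def)
  have less: "xs ! i < xs ! j" if "i < j" "j \<le> r" for i j
    using sorted_wrt_nth_less[OF xs(1)] that len by simp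
  have nonneg: "0 \<le> xs ! i" if "i \<le> r" for i
  proof -
    have "xs ! i \<in> B" using xs(2) len that nth_mem[of i xs] by simp
    then show ?thesis by (auto simp: B_def)
  qed
  have zero: "xs ! 0 = 0"
  proof -
    have "0 \<in> set xs" using xs(2) by (simp add: B_def)
    then obtain i where i: "i \<le> r" "xs ! i = 0" using len by (auto simp: in_set_conv_nth less_Suc_eq_le)
    show ?thesis
    proof (cases "i = 0")
      case False
      then show ?thesis using less[of 0 i] i nonneg[of 0] by simp
    qed (use i in simp)
  qed
  have in_xs: "\<exists>i\<le>r. xs ! i = (q' - q) / (p - p')"
    if "(p, q) \<in> F" "(p', q') \<in> F" "0 < (q' - q) / (p - p')" for p q p' q'
  proof -
    have "(q' - q) / (p - p') \<in> set xs"
      using that unfolding xs(2) B_def by force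
    then show ?thesis using len by (auto simp: in_set_conv_nth less_Suc_eq_le)
  qed
  have "affine_on {xs ! i..xs ! Suc i} (affine_min F)" if "i < r" for i
  proof (rule affine_on_affine_min[OF F])
    show "(xs ! i + xs ! Suc i) / 2 \<in> interior {xs ! i..xs ! Suc i}"
      using less[of i "Suc i"] that by simp
    fix p q p' q'
    assume pq: "(p, q) \<in> F" "(p', q') \<in> F"
    show "(q' - q) / (p - p') \<notin> interior {xs ! i..xs ! Suc i}"
    proof
      assume "(q' - q) / (p - p') \<in> interior {xs ! i..xs ! Suc i}"
      then have r: "xs ! i < (q' - q) / (p - p')" "(q' - q) / (p - p') < xs ! Suc i" by auto
      then have "0 < (q' - q) / (p - p')" using nonneg[of i] that by simp
      then obtain k where k: "k \<le> r" "xs ! k = (q' - q) / (p - p')"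
        using in_xs[OF pq] by blast
      have "i < k" using k r(1) that less[of k i] by (cases k i rule: linorder_cases) auto
      moreover have "k < Suc i"
        using k r(2) that less[of "Suc i" k] by (cases k "Suc i" rule: linorder_cases) auto
      ultimately show False by simp
    qed
  qed simp
  moreover have "affine_on {xs ! r..} (affine_min F)"
  proof (rule affine_on_affine_min[OF F])
    show "xs ! r + 1 \<in> interior {xs ! r..}" by (simp add: interior_real_atLeast)
    fix p q p' q'
    assume pq: "(p, q) \<in> F" "(p', q') \<in> F"
    show "(q' - q) / (p - p') \<notin> interior {xs ! r..}"
    proof
      assume "(q' - q) / (p - p') \<in> interior {xs ! r..}"
      then have r: "xs ! r < (q' - q) / (p - p')" by (simp add: interior_real_atLeast)
      then have "0 < (q' - q) / (p - p')" using nonneg[of r] by simp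
      then obtain k where k: "k \<le> r" "xs ! k = (q' - q) / (p - p')"
        using in_xs[OF pq] by blast
      then show False using r less[of k r] by (cases "k = r") auto
    qed
  qed simp
  ultimately show ?thesis
    unfolding finitely_piecewise_linear_def using zero less
    by (intro exI[of _ r] exI[of _ "(!) xs"]) simp
qed

section \<open>The value function\<close>

theorem proposition1:
  fixes A :: "real ^ 'n::finite ^ 'm::finite" and S :: "real ^ 'n ^ 'n"
  assumes "switching_cost_matrix S"
  shows "\<exists>v :: real \<Rightarrow> real.
    (\<forall>c\<ge>0. \<forall>j0. stationary_value A S c j0 (v c)) \<and>
    continuous_on {0..} v \<and>
    mono_on {0..} v \<and>
    concave_on {0..} v \<and>
    finitely_piecewise_linear v"
proof -
  obtain V where V: "finite V" and hull: "flow_polytope A = convex hull V"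
    using polytope_flow_polytope[of A] unfolding polytope_def by blast
  have V_flow: "V \<subseteq> flow_polytope A"
    unfolding hull by (rule hull_subset)
  \<comment> \<open>the cost of a flow as a function of \<open>c\<close>: its switching rate is the slope\<close>
  define F where "F = (\<lambda>(z, w). (switching_rate S z, \<Sum>k\<in>UNIV. w $ k)) ` V"
  have F: "finite F" "F \<noteq> {}"
    using V hull flow_polytope_nonempty[of A] by (auto simp: F_def)
  have slope: "0 \<le> p" if "(p, q) \<in> F" for p q
  proof -
    obtain z w where zw: "(z, w) \<in> flow_polytope A" and p: "p = switching_rate S z"
      using \<open>(p, q) \<in> F\<close> V_flow by (auto simp: F_def)
    have "0 \<le> z $ k $ j" "0 \<le> S $ k $ j" for k j
      using zw assms by (auto simp: flow_polytope_def switching_cost_matrix_def)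
    then show ?thesis
      unfolding p switching_rate_def by (intro sum_nonneg mult_nonneg_nonneg)
  qed
  have lower: "affine_min F c \<le> (\<Sum>k\<in>UNIV. w $ k) + c * switching_rate S z"
    if "(z, w) \<in> flow_polytope A" for z w c
  proof -
    let ?cost = "\<lambda>p. (\<Sum>k\<in>UNIV. snd p $ k) + c * switching_rate S (fst p)"
    let ?H = "{p :: (real ^ 'n ^ 'n) \<times> (real ^ 'n). - ?cost p \<le> - affine_min F c}"
    have "V \<subseteq> ?H"
    proof
      fix p
      assume "p \<in> V"
      then have "(switching_rate S (fst p), \<Sum>k\<in>UNIV. snd p $ k) \<in> F"
        by (force simp: F_def)
      from affine_min_le[OF F(1) this, of c] show "p \<in> ?H"
        by (simp add: mult.commute add.commute)
    qed
    moreover have "polyhedron ?H"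
      by (intro polyhedron_linear_le linearI)
        (simp_all add: switching_rate_def sum.distrib sum_distrib_left algebra_simps)
    ultimately have "flow_polytope A \<subseteq> ?H"
      unfolding hull by (intro hull_minimal polyhedron_imp_convex)
    with that show ?thesis by force
  qed
  have "stationary_value A S c j0 (affine_min F c)" for c j0
  proof -
    obtain p q where "(p, q) \<in> F" and v: "affine_min F c = p * c + q"
      using affine_min_attained[OF F] by blast
    then obtain z w where zw: "(z, w) \<in> V" and pq: "p = switching_rate S z" "q = (\<Sum>k\<in>UNIV. w $ k)"
      by (auto simp: F_def)
    show ?thesis
    proof (rule stationary_value_of_optimal_flow)
      show "(z, w) \<in> flow_polytope A" using zw V_flow by blast
      show "affine_min F c = (\<Sum>k\<in>UNIV. w $ k) + c * switching_rate S z"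
        by (simp add: v pq)
    qed (rule lower)
  qed
  moreover have "continuous_on {0..} (affine_min F)"
    using continuous_affine_min[OF F] by (rule continuous_on_subset) simp
  moreover have "mono (affine_min F)"
    using slope by (intro mono_affine_min F)
  then have "mono_on {0..} (affine_min F)"
    by (auto intro: mono_onI dest: monoD)
  moreover have "concave_on {0..} (affine_min F)"
    using concave_affine_min[OF F] by (auto simp: concave_on_iff)
  moreover have "finitely_piecewise_linear (affine_min F)"
    using F by (rule finitely_piecewise_linear_affine_min)
  ultimately show ?thesis by blast
qed

end
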